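(* Let $\Gamma=(V,E,o,t)$ be a connected finite graph with finite modulus $\rho\colon I\to V$. Then $\iota_{\mathfrak m}\colon\mathrm{Cl}^0_{\mathfrak m}(\Gamma)\to\widehat{\mathrm{Cl}}{}^0_{\mathfrak m}(\Gamma)$, $\mathrm{AJ}_{\mathfrak m}\colon\mathrm{Cl}^0_{\mathfrak m}(\Gamma)\to\mathrm{J}_{\mathfrak m}(\Gamma)$, $\zeta_{\mathfrak m}\colon\mathrm{J}_{\mathfrak m}(\Gamma)\to\mathrm{P}_{\mathfrak m}(\Gamma)$ and $\chi_{\mathfrak m}\colon\mathrm{P}_{\mathfrak m}(\Gamma)\to\widehat{\mathrm{Cl}}{}^0_{\mathfrak m}(\Gamma)$ are all isomorphisms, and $\chi_{\mathfrak m}\circ\zeta_{\mathfrak m}\circ\mathrm{AJ}_{\mathfrak m}=\iota_{\mathfrak m}$.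
   Context: Graph: $V\ne\emptyset$, $E$, $o,t\colon E\to V$; finite and connected. Modulus: nonempty finite family $(w_i)_{i\in I}$, $\rho(i)=w_i$, $I(v)=\rho^{-1}(v)$. $\partial=t-o$, $H_1(\Gamma)=\ker\partial$, $\partial^*v=\sum_{t(e)=v}e-\sum_{o(e)=v}e$, $\Delta_0=\partial\partial^*$; $(df)(e)=f(t(e))-f(o(e))$, $(d^*\omega)(v)=\sum_{t(e)=v}\omega(e)-\sum_{o(e)=v}\omega(e)$, $\square_0=d^*d$, $\mathcal{H}^1(\Gamma)=\ker d^*$. $\mathrm{Cl}^0_{\mathfrak m}=(\mathbb{Z}[V]_0\oplus\mathbb{Z}[I])/\{(\Delta_0x,\rho^*x)\}$ where $\rho^*v=\sum_{i\in I(v)}i$; $\widehat{\mathrm{Cl}}{}^0_{\mathfrak m}=(\operatorname{im}d^*\oplus\mathbb{Z}^I)/\{(\square_0f,f\circ\rho):f\in\mathbb{Z}^V\}$; $\iota_{\mathfrak m}$ is induced by sending vertices and elements of $I$ to their characteristic functions. Extended graph $\Gamma_{\mathfrak m}$: add a vertex $\star$ and edges $e_i$, $o(e_i)=\star$, $t(e_i)=w_i$; $C_1(\Gamma_{\mathfrak m})=\mathbb{Z}[E]\oplus\mathbb{Z}[I]$, $C^1(\Gamma_{\mathfrak m})=\mathbb{Z}^E\oplus\mathbb{Z}^I$, $d_{\mathfrak m}(f,a)=(df,f\circ\rho-a)$ on $\mathbb{Z}^V\oplus\mathbb{Z}$, $H^1(\Gamma_{\mathfrak m})=\operatorname{coker}d_{\mathfrak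 m}\cong\mathrm{Hom}(H_1(\Gamma_{\mathfrak m}),\mathbb{Z})$; $\mathcal{H}^1(\Gamma_{\mathfrak m})=\{(f,g):d^*f+r^*g=0,\ \sum_ig(i)=0\}$ with $(r^*g)(v)=\sum_{i\in I(v)}g(i)$. $\iota$ sends a 1-chain of $\Gamma_{\mathfrak m}$ to the cochain given by its coefficients; it maps $H_1(\Gamma_{\mathfrak m})$ into $\mathcal{H}^1(\Gamma_{\mathfrak m})$. $M^\vee=\mathrm{Hom}(M,\mathbb{Z})$. $\alpha_{\mathfrak m}\colon H_1(\Gamma)\to\mathcal{H}^1(\Gamma_{\mathfrak m})^\vee$, $\gamma\mapsto((f,g)\mapsto f(\gamma))$; $\mathrm{J}_{\mathfrak m}=\mathcal{H}^1(\Gamma_{\mathfrak m})^\vee/\alpha_{\mathfrak m}(H_1(\Gamma))$. $\beta_{\mathfrak m}\colon\mathcal{H}^1(\Gamma)\to H^1(\Gamma_{\mathfrak m})$, $\omega\mapsto[(\omega,0)]$; $\mathrm{P}_{\mathfrak m}=H^1(\Gamma_{\mathfrak m})/\beta_{\mathfrak m}(\mathcal{H}^1(\Gamma))$. $\mathrm{AJ}_{\mathfrak m}$ sends the class of $(\partial\gamma,0)$ to the class of $(f,g)\mapsto f(\gamma)$ and of $(0,i)$ to the class of $(f,g)\mapsto g(i)$. $\zeta_{\mathfrak m}$ is induced by the transpose $\mathcal{H}^1(\Gamma_{\mathfrak m})^\vee\to\mathrm{Hom}(H_1(\Gamma_{\mathfrak m}),\mathbb{Z})=H^1(\Gamma_{\mathfrak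 m})$ of $\iota|_{H_1(\Gamma_{\mathfrak m})}$ (which maps $\alpha_{\mathfrak m}(H_1(\Gamma))$ into $\beta_{\mathfrak m}(\mathcal{H}^1(\Gamma))$). $\chi_{\mathfrak m}$ is induced by $d^*\oplus\mathrm{id}\colon\mathbb{Z}^E\oplus\mathbb{Z}^I\to\operatorname{im}d^*\oplus\mathbb{Z}^I$. *)

theory Defs
  imports "HOL-Algebra.Free_Abelian_Groups" "Graph_Theory.Digraph_Component"
begin

text \<open>
  A graph $(V,E,o,t)$ is a record of type \<^typ>\<open>('v,'e) pre_digraph\<close> with $o$ = \<^const>\<open>tail\<close> and
  $t$ = \<^const>\<open>head\<close>; loops and multiple edges are allowed. The free abelian group $\mathbb{Z}[S]$ is
  \<^const>\<open>free_Abelian_group\<close>; the group $\mathbb{Z}^S$ consists of functions that are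
  \<^const>\<open>undefined\<close> outside \<open>S\<close>.
\<close>

definition cochains :: "'s set \<Rightarrow> ('s \<Rightarrow> int) monoid" where
  "cochains S = product_group S (\<lambda>_. integer_group)"

definition subgrp :: "'a monoid \<Rightarrow> 'a set \<Rightarrow> 'a monoid" where
  "subgrp G H = G\<lparr>carrier := H\<rparr>"

definition dual_group :: "'a monoid \<Rightarrow> ('a \<Rightarrow> int) monoid" where
  "dual_group M = \<lparr>carrier = hom M integer_group \<inter> extensional (carrier M),
                   monoid.mult = (\<lambda>\<phi> \<psi>. \<lambda>x\<in>carrier M. \<phi> x + \<psi> x),
                   one = (\<lambda>x\<in>carrier M. 0)\<rparr>"

text \<open>The linear extension of \<open>f\<close> to chains, evaluated at \<open>c\<close>.\<close>

definition chain_eval :: "('s \<Rightarrow> int) \<Rightarrow> ('s \<Rightarrow>\<^sub>0 int) \<Rightarrow> int" where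
  "chain_eval f c = (\<Sum>x\<in>Poly_Mapping.keys c. Poly_Mapping.lookup c x * f x)"

definition chain_degree :: "('s \<Rightarrow>\<^sub>0 int) \<Rightarrow> int" where
  "chain_degree c = (\<Sum>x\<in>Poly_Mapping.keys c. Poly_Mapping.lookup c x)"

text \<open>The linear extension of sending \<open>s \<in> S\<close> to its characteristic function.\<close>

definition chain_to_cochain :: "'s set \<Rightarrow> ('s \<Rightarrow>\<^sub>0 int) \<Rightarrow> 's \<Rightarrow> int" where
  "chain_to_cochain S c = (\<lambda>s\<in>S. Poly_Mapping.lookup c s)"

text \<open>
  The map induced on a quotient by a map \<open>f\<close> that is constant on cosets.
\<close>

definition quot_map :: "('a \<Rightarrow> 'b) \<Rightarrow> 'a set \<Rightarrow> 'b" where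
  "quot_map f X = the_elem (f ` X)"


section \<open>Chains and cochains of a graph\<close>

definition boundary :: "('v, 'e) pre_digraph \<Rightarrow> ('e \<Rightarrow>\<^sub>0 int) \<Rightarrow> 'v \<Rightarrow>\<^sub>0 int" where
  "boundary G = frag_extend (\<lambda>e. frag_of (head G e) - frag_of (tail G e))"

definition boundary_adj :: "('v, 'e) pre_digraph \<Rightarrow> ('v \<Rightarrow>\<^sub>0 int) \<Rightarrow> 'e \<Rightarrow>\<^sub>0 int" where
  "boundary_adj G = frag_extend (\<lambda>v. (\<Sum>e | e \<in> arcs G \<and> head G e = v. frag_of e)
                                   - (\<Sum>e | e \<in> arcs G \<and> tail G e = v. frag_of e))"

definition laplace_chain :: "('v, 'e) pre_digraph \<Rightarrow> ('v \<Rightarrow>\<^sub>0 int) \<Rightarrow> 'v \<Rightarrow>\<^sub>0 int" where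
  "laplace_chain G x = boundary G (boundary_adj G x)"

definition cycles :: "('v, 'e) pre_digraph \<Rightarrow> ('e \<Rightarrow>\<^sub>0 int) set" where
  "cycles G = kernel (free_Abelian_group (arcs G)) (free_Abelian_group (verts G)) (boundary G)"

definition diff :: "('v, 'e) pre_digraph \<Rightarrow> ('v \<Rightarrow> int) \<Rightarrow> 'e \<Rightarrow> int" where
  "diff G f = (\<lambda>e\<in>arcs G. f (head G e) - f (tail G e))"

definition diff_adj :: "('v, 'e) pre_digraph \<Rightarrow> ('e \<Rightarrow> int) \<Rightarrow> 'v \<Rightarrow> int" where
  "diff_adj G \<omega> = (\<lambda>v\<in>verts G. (\<Sum>e | e \<in> arcs G \<and> head G e = v. \<omega> e)
                                - (\<Sum>e | e \<in> arcs G \<and> tail G e = v. \<omega> e))"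

definition laplace_cochain :: "('v, 'e) pre_digraph \<Rightarrow> ('v \<Rightarrow> int) \<Rightarrow> 'v \<Rightarrow> int" where
  "laplace_cochain G f = diff_adj G (diff G f)"

definition harmonic :: "('v, 'e) pre_digraph \<Rightarrow> ('e \<Rightarrow> int) set" where
  "harmonic G = kernel (cochains (arcs G)) (cochains (verts G)) (diff_adj G)"


section \<open>The class groups with modulus\<close>

definition rho_pull_chain :: "'i set \<Rightarrow> ('i \<Rightarrow> 'v) \<Rightarrow> ('v \<Rightarrow>\<^sub>0 int) \<Rightarrow> 'i \<Rightarrow>\<^sub>0 int" where
  "rho_pull_chain I \<rho> = frag_extend (\<lambda>v. \<Sum>i | i \<in> I \<and> \<rho> i = v. frag_of i)"

definition Cl_amb :: "('v, 'e) pre_digraph \<Rightarrow> 'i set \<Rightarrow> (('v \<Rightarrow>\<^sub>0 int) \<times> ('i \<Rightarrow>\<^sub>0 int)) monoid" where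
  "Cl_amb G I = subgrp (free_Abelian_group (verts G))
                  {x \<in> carrier (free_Abelian_group (verts G)). chain_degree x = 0}
                \<times>\<times> free_Abelian_group I"

definition Cl_rel :: "('v, 'e) pre_digraph \<Rightarrow> 'i set \<Rightarrow> ('i \<Rightarrow> 'v) \<Rightarrow> (('v \<Rightarrow>\<^sub>0 int) \<times> ('i \<Rightarrow>\<^sub>0 int)) set" where
  "Cl_rel G I \<rho> = (\<lambda>x. (laplace_chain G x, rho_pull_chain I \<rho> x)) ` carrier (free_Abelian_group (verts G))"

definition Cl :: "('v, 'e) pre_digraph \<Rightarrow> 'i set \<Rightarrow> ('i \<Rightarrow> 'v) \<Rightarrow> (('v \<Rightarrow>\<^sub>0 int) \<times> ('i \<Rightarrow>\<^sub>0 int)) set monoid" where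
  "Cl G I \<rho> = Cl_amb G I Mod Cl_rel G I \<rho>"

definition Clhat_amb :: "('v, 'e) pre_digraph \<Rightarrow> 'i set \<Rightarrow> (('v \<Rightarrow> int) \<times> ('i \<Rightarrow> int)) monoid" where
  "Clhat_amb G I = subgrp (cochains (verts G)) (diff_adj G ` carrier (cochains (arcs G))) \<times>\<times> cochains I"

definition Clhat_rel :: "('v, 'e) pre_digraph \<Rightarrow> 'i set \<Rightarrow> ('i \<Rightarrow> 'v) \<Rightarrow> (('v \<Rightarrow> int) \<times> ('i \<Rightarrow> int)) set" where
  "Clhat_rel G I \<rho> = (\<lambda>f. (laplace_cochain G f, \<lambda>i\<in>I. f (\<rho> i))) ` carrier (cochains (verts G))"

definition Clhat :: "('v, 'e) pre_digraph \<Rightarrow> 'i set \<Rightarrow> ('i \<Rightarrow> 'v) \<Rightarrow> (('v \<Rightarrow> int) \<times> ('i \<Rightarrow> int)) set monoid" where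
  "Clhat G I \<rho> = Clhat_amb G I Mod Clhat_rel G I \<rho>"

definition Clhat_class ::
  "('v, 'e) pre_digraph \<Rightarrow> 'i set \<Rightarrow> ('i \<Rightarrow> 'v) \<Rightarrow> ('v \<Rightarrow> int) \<times> ('i \<Rightarrow> int) \<Rightarrow> (('v \<Rightarrow> int) \<times> ('i \<Rightarrow> int)) set" where
  "Clhat_class G I \<rho> z = Clhat_rel G I \<rho> #>\<^bsub>Clhat_amb G I\<^esub> z"


section \<open>The extended graph\<close>

text \<open>
  The vertex \<open>\<star>\<close> is \<^const>\<open>None\<close> and the edge \<open>e\<^sub>i\<close> is \<open>Inr i\<close>. Its chain and cochain groups are used
  below in the split form $\mathbb{Z}[E]\oplus\mathbb{Z}[I]$, $\mathbb{Z}[V]\oplus\mathbb{Z}$,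
  $\mathbb{Z}^E\oplus\mathbb{Z}^I$, $\mathbb{Z}^V\oplus\mathbb{Z}$.
\<close>

definition ext_graph :: "('v, 'e) pre_digraph \<Rightarrow> 'i set \<Rightarrow> ('i \<Rightarrow> 'v) \<Rightarrow> ('v option, 'e + 'i) pre_digraph" where
  "ext_graph G I \<rho> = \<lparr>verts = insert None (Some ` verts G), arcs = arcs G <+> I,
                      tail = case_sum (\<lambda>e. Some (tail G e)) (\<lambda>i. None),
                      head = case_sum (\<lambda>e. Some (head G e)) (\<lambda>i. Some (\<rho> i))\<rparr>"

definition ext_chains1 :: "('v, 'e) pre_digraph \<Rightarrow> 'i set \<Rightarrow> (('e \<Rightarrow>\<^sub>0 int) \<times> ('i \<Rightarrow>\<^sub>0 int)) monoid" where
  "ext_chains1 G I = free_Abelian_group (arcs G) \<times>\<times> free_Abelian_group I"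

definition ext_cochains1 :: "('v, 'e) pre_digraph \<Rightarrow> 'i set \<Rightarrow> (('e \<Rightarrow> int) \<times> ('i \<Rightarrow> int)) monoid" where
  "ext_cochains1 G I = cochains (arcs G) \<times>\<times> cochains I"

definition ext_boundary ::
  "('v, 'e) pre_digraph \<Rightarrow> ('i \<Rightarrow> 'v) \<Rightarrow> ('e \<Rightarrow>\<^sub>0 int) \<times> ('i \<Rightarrow>\<^sub>0 int) \<Rightarrow> ('v \<Rightarrow>\<^sub>0 int) \<times> int" where
  "ext_boundary G \<rho> = (\<lambda>(c, b). (boundary G c + frag_extend (\<lambda>i. frag_of (\<rho> i)) b, - chain_degree b))"

definition ext_diff ::
  "('v, 'e) pre_digraph \<Rightarrow> 'i set \<Rightarrow> ('i \<Rightarrow> 'v) \<Rightarrow> ('v \<Rightarrow> int) \<times> int \<Rightarrow> ('e \<Rightarrow> int) \<times> ('i \<Rightarrow> int)" where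
  "ext_diff G I \<rho> = (\<lambda>(f, a). (diff G f, \<lambda>i\<in>I. f (\<rho> i) - a))"

definition ext_H1 ::
  "('v, 'e) pre_digraph \<Rightarrow> 'i set \<Rightarrow> ('i \<Rightarrow> 'v) \<Rightarrow> (('e \<Rightarrow>\<^sub>0 int) \<times> ('i \<Rightarrow>\<^sub>0 int)) monoid" where
  "ext_H1 G I \<rho> = subgrp (ext_chains1 G I)
     (kernel (ext_chains1 G I) (free_Abelian_group (verts G) \<times>\<times> integer_group) (ext_boundary G \<rho>))"

definition ext_coboundaries ::
  "('v, 'e) pre_digraph \<Rightarrow> 'i set \<Rightarrow> ('i \<Rightarrow> 'v) \<Rightarrow> (('e \<Rightarrow> int) \<times> ('i \<Rightarrow> int)) set" where
  "ext_coboundaries G I \<rho> = ext_diff G I \<rho> ` carrier (cochains (verts G) \<times>\<times> integer_group)"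

definition ext_coH1 ::
  "('v, 'e) pre_digraph \<Rightarrow> 'i set \<Rightarrow> ('i \<Rightarrow> 'v) \<Rightarrow> (('e \<Rightarrow> int) \<times> ('i \<Rightarrow> int)) set monoid" where
  "ext_coH1 G I \<rho> = ext_cochains1 G I Mod ext_coboundaries G I \<rho>"

definition rho_push_cochain :: "'i set \<Rightarrow> ('i \<Rightarrow> 'v) \<Rightarrow> ('i \<Rightarrow> int) \<Rightarrow> 'v \<Rightarrow> int" where
  "rho_push_cochain I \<rho> g v = (\<Sum>i | i \<in> I \<and> \<rho> i = v. g i)"

definition ext_harmonic ::
  "('v, 'e) pre_digraph \<Rightarrow> 'i set \<Rightarrow> ('i \<Rightarrow> 'v) \<Rightarrow> (('e \<Rightarrow> int) \<times> ('i \<Rightarrow> int)) monoid" where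
  "ext_harmonic G I \<rho> = subgrp (ext_cochains1 G I)
     {(f, g) \<in> carrier (ext_cochains1 G I).
        (\<forall>v\<in>verts G. diff_adj G f v + rho_push_cochain I \<rho> g v = 0) \<and> (\<Sum>i\<in>I. g i) = 0}"

text \<open>
  The next three lemmas identify the split forms with the boundary, the differential and its adjoint
  of the extended graph.
\<close>

lemma chain_degree_conv:
  "finite S \<Longrightarrow> Poly_Mapping.keys b \<subseteq> S \<Longrightarrow> chain_degree b = (\<Sum>i\<in>S. Poly_Mapping.lookup b i)"
  unfolding chain_degree_def by (rule sum.mono_neutral_left) (auto simp: in_keys_iff)

lemma chain_degree_diff: "chain_degree (a - b) = chain_degree a - chain_degree b"
proof -
  let ?S = "Poly_Mapping.keys a \<union> Poly_Mapping.keys b"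
  have "Poly_Mapping.keys (a - b) \<subseteq> ?S" by (rule keys_diff)
  then show ?thesis
    by (simp add: chain_degree_conv[of ?S] lookup_minus sum_subtractf)
qed

lemma boundary_ext_graph:
  "boundary (ext_graph G I \<rho>) (frag_extend (frag_of \<circ> Inl) c + frag_extend (frag_of \<circ> Inr) b)
   = frag_extend (frag_of \<circ> Some) (fst (ext_boundary G \<rho> (c, b)))
     + frag_cmul (snd (ext_boundary G \<rho> (c, b))) (frag_of None)"
proof -
  define \<delta> where "\<delta> = boundary (ext_graph G I \<rho>)"
  define L where "L = frag_extend (frag_of \<circ> (Inl :: _ \<Rightarrow> 'b + 'c))"
  define R where "R = frag_extend (frag_of \<circ> (Inr :: _ \<Rightarrow> 'b + 'c))"
  define S where "S = frag_extend (frag_of \<circ> (Some :: 'a \<Rightarrow> _))"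
  define r where "r = frag_extend (\<lambda>i. frag_of (\<rho> i))"
  have add: "\<delta> (x + y) = \<delta> x + \<delta> y" "S (u + v) = S u + S v" for x y u v
    by (simp_all add: \<delta>_def S_def boundary_def frag_extend_add)
  have diffs: "\<delta> (x - y) = \<delta> x - \<delta> y" "L (c - c') = L c - L c'" "R (b - b') = R b - R b'"
    "S (u - v) = S u - S v" "r (b - b') = r b - r b'" "boundary G (c - c') = boundary G c - boundary G c'"
    for x y c c' b b' u v
    by (simp_all add: \<delta>_def L_def R_def S_def r_def boundary_def frag_extend_diff)
  have zeros: "\<delta> 0 = 0" "L 0 = 0" "R 0 = 0" "S 0 = 0" "r 0 = 0" "boundary G 0 = 0"
    by (simp_all add: \<delta>_def L_def R_def S_def r_def boundary_def)
  have c: "\<delta> (L c) = S (boundary G c)"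
    using subset_UNIV[of "Poly_Mapping.keys c"]
  proof (induction c rule: frag_induction)
    case (one e)
    show ?case by (simp add: \<delta>_def L_def S_def boundary_def ext_graph_def frag_extend_diff)
  qed (simp_all add: diffs zeros)
  have b: "\<delta> (R b) = S (r b) - frag_cmul (chain_degree b) (frag_of None)"
    using subset_UNIV[of "Poly_Mapping.keys b"]
  proof (induction b rule: frag_induction)
    case zero
    show ?case by (simp add: zeros chain_degree_def)
  next
    case (one i)
    show ?case by (simp add: \<delta>_def R_def S_def r_def boundary_def ext_graph_def chain_degree_def)
  next
    case (diff b b')
    then show ?case by (simp add: diffs chain_degree_diff frag_cmul_diff_distrib)
  qed
  have neg: "frag_cmul (- chain_degree b) (frag_of None) = - frag_cmul (chain_degree b) (frag_of (None :: 'a option))"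
    using frag_cmul_diff_distrib[of 0 "chain_degree b" "frag_of None"] by simp
  have "\<delta> (L c + R b) = S (boundary G c + r b) + frag_cmul (- chain_degree b) (frag_of None)"
    unfolding add b c neg by simp
  then show ?thesis
    by (simp only: ext_boundary_def \<delta>_def L_def R_def S_def r_def prod.case fst_conv snd_conv)
qed

lemma diff_ext_graph:
  "diff (ext_graph G I \<rho>) (case_option a f)
   = (\<lambda>x\<in>arcs G <+> I. case_sum (fst (ext_diff G I \<rho> (f, a))) (snd (ext_diff G I \<rho> (f, a))) x)"
  by (auto simp: diff_def ext_diff_def ext_graph_def fun_eq_iff split: sum.splits)

lemma diff_adj_ext_graph:
  assumes "finite (arcs G)" "finite I"
  shows "diff_adj (ext_graph G I \<rho>) (case_sum f g)
    = (\<lambda>x\<in>insert None (Some ` verts G). case x of None \<Rightarrow> - (\<Sum>i\<in>I. g i)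
         | Some v \<Rightarrow> diff_adj G f v + rho_push_cochain I \<rho> g v)"
proof -
  have 1: "{e. e \<in> arcs G <+> I \<and> case_sum (\<lambda>e. Some (head G e)) (\<lambda>i. Some (\<rho> i)) e = Some v}
     = {e \<in> arcs G. head G e = v} <+> {i \<in> I. \<rho> i = v}" for v
    by auto
  have 2: "{e. e \<in> arcs G <+> I \<and> case_sum (\<lambda>e. Some (tail G e)) (\<lambda>i. None) e = Some v}
     = {e \<in> arcs G. tail G e = v} <+> {}" for v
    by auto
  have 3: "{e. e \<in> arcs G <+> I \<and> case_sum (\<lambda>e. Some (head G e)) (\<lambda>i. Some (\<rho> i)) e = None} = {}"
    by auto
  have 4: "{e. e \<in> arcs G <+> I \<and> case_sum (\<lambda>e. Some (tail G e)) (\<lambda>i. None) e = None} = {} <+> I"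
    by auto
  show ?thesis
    using assms
    by (auto simp: fun_eq_iff diff_adj_def ext_graph_def 1 2 3 4 sum.Plus rho_push_cochain_def)
qed

definition ext_chain_to_cochain ::
  "('v, 'e) pre_digraph \<Rightarrow> 'i set \<Rightarrow> ('e \<Rightarrow>\<^sub>0 int) \<times> ('i \<Rightarrow>\<^sub>0 int) \<Rightarrow> ('e \<Rightarrow> int) \<times> ('i \<Rightarrow> int)" where
  "ext_chain_to_cochain G I = (\<lambda>(c, b). (chain_to_cochain (arcs G) c, chain_to_cochain I b))"

definition ext_eval :: "('e \<Rightarrow> int) \<times> ('i \<Rightarrow> int) \<Rightarrow> ('e \<Rightarrow>\<^sub>0 int) \<times> ('i \<Rightarrow>\<^sub>0 int) \<Rightarrow> int" where
  "ext_eval = (\<lambda>(f, g) (c, b). chain_eval f c + chain_eval g b)"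

text \<open>The isomorphism from cohomology to the dual of homology induced by evaluation.\<close>

definition ext_universal_coeff ::
  "('v, 'e) pre_digraph \<Rightarrow> 'i set \<Rightarrow> ('i \<Rightarrow> 'v) \<Rightarrow> (('e \<Rightarrow> int) \<times> ('i \<Rightarrow> int)) set
     \<Rightarrow> ('e \<Rightarrow>\<^sub>0 int) \<times> ('i \<Rightarrow>\<^sub>0 int) \<Rightarrow> int" where
  "ext_universal_coeff G I \<rho> = quot_map (\<lambda>w. \<lambda>z\<in>carrier (ext_H1 G I \<rho>). ext_eval w z)"


section \<open>Jacobian and Picard groups with modulus\<close>

definition alpha_m ::
  "('v, 'e) pre_digraph \<Rightarrow> 'i set \<Rightarrow> ('i \<Rightarrow> 'v) \<Rightarrow> ('e \<Rightarrow>\<^sub>0 int) \<Rightarrow> ('e \<Rightarrow> int) \<times> ('i \<Rightarrow> int) \<Rightarrow> int" where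
  "alpha_m G I \<rho> \<gamma> = (\<lambda>(f, g)\<in>carrier (ext_harmonic G I \<rho>). chain_eval f \<gamma>)"

definition Jac ::
  "('v, 'e) pre_digraph \<Rightarrow> 'i set \<Rightarrow> ('i \<Rightarrow> 'v) \<Rightarrow> (('e \<Rightarrow> int) \<times> ('i \<Rightarrow> int) \<Rightarrow> int) set monoid" where
  "Jac G I \<rho> = dual_group (ext_harmonic G I \<rho>) Mod (alpha_m G I \<rho> ` cycles G)"

definition beta_m ::
  "('v, 'e) pre_digraph \<Rightarrow> 'i set \<Rightarrow> ('i \<Rightarrow> 'v) \<Rightarrow> ('e \<Rightarrow> int) \<Rightarrow> (('e \<Rightarrow> int) \<times> ('i \<Rightarrow> int)) set" where
  "beta_m G I \<rho> \<omega> = ext_coboundaries G I \<rho> #>\<^bsub>ext_cochains1 G I\<^esub> (\<omega>, \<lambda>i\<in>I. 0)"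

definition Pic ::
  "('v, 'e) pre_digraph \<Rightarrow> 'i set \<Rightarrow> ('i \<Rightarrow> 'v) \<Rightarrow> (('e \<Rightarrow> int) \<times> ('i \<Rightarrow> int)) set set monoid" where
  "Pic G I \<rho> = ext_coH1 G I \<rho> Mod (beta_m G I \<rho> ` harmonic G)"


section \<open>The four maps\<close>

definition iota_m ::
  "('v, 'e) pre_digraph \<Rightarrow> 'i set \<Rightarrow> ('i \<Rightarrow> 'v) \<Rightarrow> (('v \<Rightarrow>\<^sub>0 int) \<times> ('i \<Rightarrow>\<^sub>0 int)) set
     \<Rightarrow> (('v \<Rightarrow> int) \<times> ('i \<Rightarrow> int)) set" where
  "iota_m G I \<rho> =
     quot_map (\<lambda>(x, b). Clhat_class G I \<rho> (chain_to_cochain (verts G) x, chain_to_cochain I b))"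

text \<open>
  By linearity, the prescribed values mean that the class of \<open>(\<partial>\<gamma>, b)\<close> is sent to the class of
  \<open>(f, g) \<mapsto> f(\<gamma>) + g(b)\<close>. On a connected graph every class has such representatives; the value is the
  only element of the set of classes so obtained.
\<close>

definition AJ_m ::
  "('v, 'e) pre_digraph \<Rightarrow> 'i set \<Rightarrow> ('i \<Rightarrow> 'v) \<Rightarrow> (('v \<Rightarrow>\<^sub>0 int) \<times> ('i \<Rightarrow>\<^sub>0 int)) set
     \<Rightarrow> (('e \<Rightarrow> int) \<times> ('i \<Rightarrow> int) \<Rightarrow> int) set" where
  "AJ_m G I \<rho> X = the_elem
     {(alpha_m G I \<rho> ` cycles G) #>\<^bsub>dual_group (ext_harmonic G I \<rho>)\<^esub>
          (\<lambda>w\<in>carrier (ext_harmonic G I \<rho>). ext_eval w (\<gamma>, b)) | \<gamma> b.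
        \<gamma> \<in> carrier (free_Abelian_group (arcs G)) \<and> (boundary G \<gamma>, b) \<in> X}"

definition iota_transpose ::
  "('v, 'e) pre_digraph \<Rightarrow> 'i set \<Rightarrow> ('i \<Rightarrow> 'v) \<Rightarrow> (('e \<Rightarrow> int) \<times> ('i \<Rightarrow> int) \<Rightarrow> int)
     \<Rightarrow> ('e \<Rightarrow>\<^sub>0 int) \<times> ('i \<Rightarrow>\<^sub>0 int) \<Rightarrow> int" where
  "iota_transpose G I \<rho> \<phi> = (\<lambda>z\<in>carrier (ext_H1 G I \<rho>). \<phi> (ext_chain_to_cochain G I z))"

definition zeta_m ::
  "('v, 'e) pre_digraph \<Rightarrow> 'i set \<Rightarrow> ('i \<Rightarrow> 'v) \<Rightarrow> (('e \<Rightarrow> int) \<times> ('i \<Rightarrow> int) \<Rightarrow> int) set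
     \<Rightarrow> (('e \<Rightarrow> int) \<times> ('i \<Rightarrow> int)) set set" where
  "zeta_m G I \<rho> =
     quot_map (\<lambda>\<phi>. (beta_m G I \<rho> ` harmonic G) #>\<^bsub>ext_coH1 G I \<rho>\<^esub>
       inv_into (carrier (ext_coH1 G I \<rho>)) (ext_universal_coeff G I \<rho>) (iota_transpose G I \<rho> \<phi>))"

text \<open>\<^const>\<open>AJ_m\<close> is well defined and takes the prescribed values.\<close>

lemma chain_eval_conv:
  "finite S \<Longrightarrow> Poly_Mapping.keys b \<subseteq> S \<Longrightarrow> chain_eval f b = (\<Sum>i\<in>S. Poly_Mapping.lookup b i * f i)"
  unfolding chain_eval_def by (rule sum.mono_neutral_left) (auto simp: in_keys_iff)

lemma chain_eval_diff: "chain_eval f (a - b) = chain_eval f a - chain_eval f b"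
proof -
  let ?S = "Poly_Mapping.keys a \<union> Poly_Mapping.keys b"
  have "Poly_Mapping.keys (a - b) \<subseteq> ?S" by (rule keys_diff)
  then show ?thesis
    by (simp add: chain_eval_conv[of ?S] lookup_minus sum_subtractf left_diff_distrib)
qed

lemma chain_eval_add: "chain_eval f (a + b) = chain_eval f a + chain_eval f b"
  using chain_eval_diff[of f "a + b" b] by simp

lemma chain_eval_sum_frag_of: "finite S \<Longrightarrow> chain_eval f (\<Sum>x\<in>S. frag_of (h x)) = (\<Sum>x\<in>S. f (h x))"
  by (induction S rule: finite_induct) (simp_all add: chain_eval_add, simp_all add: chain_eval_def)

lemma chain_eval_adjoint:
  assumes fin: "finite (arcs G)" "finite I"
    and w: "(f, g) \<in> carrier (ext_harmonic G I \<rho>)"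
    and x: "Poly_Mapping.keys x \<subseteq> verts G"
  shows "chain_eval f (boundary_adj G x) + chain_eval g (rho_pull_chain I \<rho> x) = 0"
  using x
proof (induction x rule: frag_induction)
  case zero
  show ?case by (simp add: boundary_adj_def rho_pull_chain_def chain_eval_def)
next
  case (one v)
  have "diff_adj G f v + rho_push_cochain I \<rho> g v = 0"
    using w one by (auto simp: ext_harmonic_def subgrp_def)
  then show ?case
    using fin one
    by (simp add: boundary_adj_def rho_pull_chain_def chain_eval_diff chain_eval_sum_frag_of[where h="\<lambda>x. x"]
        diff_adj_def rho_push_cochain_def)
next
  case (diff a b)
  then show ?case
    by (simp add: boundary_adj_def rho_pull_chain_def frag_extend_diff chain_eval_diff)
qed

lemma keys_boundary_adj:
  fixes G :: "('v, 'e) pre_digraph"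
  shows "Poly_Mapping.keys (boundary_adj G x) \<subseteq> arcs G"
proof -
  have *: "Poly_Mapping.keys (\<Sum>e | e \<in> arcs G \<and> P e. frag_of e) \<subseteq> arcs G" for P
    using keys_sum[of frag_of "{e. e \<in> arcs G \<and> P e}"] by auto
  show ?thesis
    unfolding boundary_adj_def
    by (intro order_trans[OF keys_frag_extend] UN_least order_trans[OF keys_diff] Un_least *)
qed

lemma AJ_m_class:
  assumes fin: "finite (arcs G)" "finite I"
    and \<gamma>: "\<gamma> \<in> carrier (free_Abelian_group (arcs G))"
  shows "AJ_m G I \<rho> (Cl_rel G I \<rho> #>\<^bsub>Cl_amb G I\<^esub> (boundary G \<gamma>, b))
       = (alpha_m G I \<rho> ` cycles G) #>\<^bsub>dual_group (ext_harmonic G I \<rho>)\<^esub>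
           (\<lambda>w\<in>carrier (ext_harmonic G I \<rho>). ext_eval w (\<gamma>, b))"
    (is "AJ_m G I \<rho> ?X = ?class \<gamma> b")
proof -
  let ?H = "carrier (ext_harmonic G I \<rho>)"
  have X: "?X = {(laplace_chain G x + boundary G \<gamma>, rho_pull_chain I \<rho> x + b) | x.
                   Poly_Mapping.keys x \<subseteq> verts G}"
    by (auto simp: r_coset_def Cl_rel_def Cl_amb_def subgrp_def DirProd_def)
  have "?class \<gamma>' b' = ?class \<gamma> b"
    if \<gamma>': "\<gamma>' \<in> carrier (free_Abelian_group (arcs G))" and mem: "(boundary G \<gamma>', b') \<in> ?X" for \<gamma>' b'
  proof -
    obtain x where x: "Poly_Mapping.keys x \<subseteq> verts G"
      "boundary G \<gamma>' = laplace_chain G x + boundary G \<gamma>" "b' = rho_pull_chain I \<rho> x + b"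
      using mem unfolding X by auto
    define z where "z = \<gamma>' - boundary_adj G x - \<gamma>"
    have bz: "boundary G z = 0"
      using x(2) by (simp add: z_def boundary_def laplace_chain_def frag_extend_diff)
    have kz: "Poly_Mapping.keys z \<subseteq> arcs G"
      unfolding z_def using \<gamma> \<gamma>' keys_boundary_adj[of G x] keys_diff
      by (metis (no_types, opaque_lifting) Un_least carrier_free_Abelian_group_iff order_trans)
    have z: "z \<in> cycles G"
      using bz kz by (simp add: cycles_def kernel_def)
    have ev: "ext_eval w (\<gamma>', b') = (case w of (f, g) \<Rightarrow> chain_eval f z) + ext_eval w (\<gamma>, b)" if w: "w \<in> ?H" for w
    proof -
      obtain f g where fg: "w = (f, g)" by force
      have "chain_eval f (boundary_adj G x) + chain_eval g (rho_pull_chain I \<rho> x) = 0"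
        using chain_eval_adjoint[OF fin _ x(1)] w fg by blast
      then show ?thesis
        by (simp add: fg ext_eval_def z_def x(3) chain_eval_add chain_eval_diff)
    qed
    have cyc_add: "c + z \<in> cycles G" "c - z \<in> cycles G" if "c \<in> cycles G" for c
      using that bz kz keys_add[of c z] keys_diff[of c z]
      by (auto simp: cycles_def kernel_def boundary_def frag_extend_add frag_extend_diff)
    have cosets: "?class \<gamma>'' b'' = (\<lambda>c. \<lambda>w\<in>?H. (case w of (f, g) \<Rightarrow> chain_eval f c) + ext_eval w (\<gamma>'', b'')) ` cycles G"
      for \<gamma>'' b''
      by (auto simp: r_coset_def dual_group_def alpha_m_def image_iff fun_eq_iff split: prod.splits
               cong: restrict_cong)
    have "(\<lambda>c. \<lambda>w\<in>?H. (case w of (f, g) \<Rightarrow> chain_eval f c) + ext_eval w (\<gamma>', b')) ` cycles G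
        = (\<lambda>c. \<lambda>w\<in>?H. (case w of (f, g) \<Rightarrow> chain_eval f (c + z)) + ext_eval w (\<gamma>, b)) ` cycles G"
      by (intro image_cong refl restrict_ext) (auto simp: ev chain_eval_add split: prod.splits)
    also have "\<dots> = (\<lambda>c. \<lambda>w\<in>?H. (case w of (f, g) \<Rightarrow> chain_eval f c) + ext_eval w (\<gamma>, b)) ` (\<lambda>c. c + z) ` cycles G"
      by (simp add: image_image)
    also have "(\<lambda>c. c + z) ` cycles G = cycles G"
    proof
      show "cycles G \<subseteq> (\<lambda>c. c + z) ` cycles G"
        by (rule subsetI, rule_tac x="_ - z" in image_eqI) (auto intro: cyc_add)
    qed (use cyc_add in auto)
    finally show ?thesis unfolding cosets .
  qed
  moreover have "(boundary G \<gamma>, b) \<in> ?X"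
    unfolding X
    by (rule CollectI, rule exI[of _ 0])
       (simp add: laplace_chain_def boundary_def boundary_adj_def rho_pull_chain_def)
  ultimately have "{?class \<gamma>' b' | \<gamma>' b'. \<gamma>' \<in> carrier (free_Abelian_group (arcs G))
                      \<and> (boundary G \<gamma>', b') \<in> ?X} = {?class \<gamma> b}"
    using \<gamma> by blast
  then show ?thesis
    by (simp only: AJ_m_def the_elem_eq)
qed

corollary AJ_m_boundary:
  assumes "finite (arcs G)" "finite I" "\<gamma> \<in> carrier (free_Abelian_group (arcs G))"
  shows "AJ_m G I \<rho> (Cl_rel G I \<rho> #>\<^bsub>Cl_amb G I\<^esub> (boundary G \<gamma>, 0))
       = (alpha_m G I \<rho> ` cycles G) #>\<^bsub>dual_group (ext_harmonic G I \<rho>)\<^esub>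
           (\<lambda>(f, g)\<in>carrier (ext_harmonic G I \<rho>). chain_eval f \<gamma>)"
proof -
  have "(\<lambda>w\<in>carrier (ext_harmonic G I \<rho>). ext_eval w (\<gamma>, 0))
      = (\<lambda>(f, g)\<in>carrier (ext_harmonic G I \<rho>). chain_eval f \<gamma>)"
    by (rule restrict_ext) (auto simp: ext_eval_def chain_eval_def)
  then show ?thesis
    using AJ_m_class[OF assms, of \<rho> 0] by simp
qed

corollary AJ_m_point:
  assumes "finite (arcs G)" "finite I"
  shows "AJ_m G I \<rho> (Cl_rel G I \<rho> #>\<^bsub>Cl_amb G I\<^esub> (0, frag_of i))
       = (alpha_m G I \<rho> ` cycles G) #>\<^bsub>dual_group (ext_harmonic G I \<rho>)\<^esub>
           (\<lambda>(f, g)\<in>carrier (ext_harmonic G I \<rho>). g i)"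
proof -
  have "(\<lambda>w\<in>carrier (ext_harmonic G I \<rho>). ext_eval w (0, frag_of i))
      = (\<lambda>(f, g)\<in>carrier (ext_harmonic G I \<rho>). g i)"
    by (rule restrict_ext) (auto simp: ext_eval_def chain_eval_def)
  then show ?thesis
    using AJ_m_class[OF assms, of 0 \<rho> "frag_of i"] by (simp add: boundary_def)
qed


text \<open>The Picard group is an iterated quotient, so \<^const>\<open>quot_map\<close> is applied twice.\<close>

definition chi_m ::
  "('v, 'e) pre_digraph \<Rightarrow> 'i set \<Rightarrow> ('i \<Rightarrow> 'v) \<Rightarrow> (('e \<Rightarrow> int) \<times> ('i \<Rightarrow> int)) set set
     \<Rightarrow> (('v \<Rightarrow> int) \<times> ('i \<Rightarrow> int)) set" where
  "chi_m G I \<rho> = quot_map (quot_map (\<lambda>(\<omega>, h). Clhat_class G I \<rho> (diff_adj G \<omega>, h)))"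

end

theory Submission
  imports Defs
begin

text \<open>
  Taking coefficients identifies chains with cochains and intertwines \<open>\<partial>\<close> with \<open>d\<^sup>*\<close> and
  \<open>\<partial>\<^sup>*\<close> with \<open>d\<close>; on a connected graph the image of \<open>\<partial>\<close> is the group of chains of degree 0, so
  \<open>\<iota>\<^sub>m\<close> is an isomorphism. The map \<open>\<chi>\<^sub>m\<close> is handled by computing the kernel of \<open>d\<^sup>* \<oplus> id\<close>
  modulo the relations. For \<open>\<zeta>\<^sub>m\<close>, coefficients map the cycles of the extended graph onto its harmonic
  cochains, and the universal coefficient map is invertible because paths from \<open>\<star>\<close> retract the chains
  onto the cycles. The diagram is checked on the classes of \<open>(\<partial>\<gamma>, b)\<close>, where it is the symmetry of
  the coefficient pairing; that \<open>AJ\<^sub>m\<close> is an isomorphism then follows from the other three.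
\<close>

section \<open>Maps induced on quotients\<close>

text \<open>Every element of the coset is \<open>k \<otimes> a\<close> with \<open>h k\<close>
  trivial, so its image under \<open>h\<close> is a singleton, from which \<open>the_elem\<close>
  reads off the value.\<close>

lemma quot_map_coset:
  assumes "K \<lhd> A" "group H" "h \<in> hom A H" "K \<subseteq> kernel A H h" "a \<in> carrier A"
  shows "quot_map h (K #>\<^bsub>A\<^esub> a) = h a"
proof -
  interpret K: normal K A by fact
  have "h (k \<otimes>\<^bsub>A\<^esub> a) = h a" if "k \<in> K" for k
  proof -
    have "k \<in> carrier A" "h k = \<one>\<^bsub>H\<^esub>" using that assms(4) by (auto simp: kernel_def)
    then show ?thesis
      using assms by (simp add: hom_mult hom_in_carrier group.is_monoid monoid.l_one)
  qed
  moreover have "K \<noteq> {}" using subgroup.one_closed[OF K.subgroup_axioms] by blast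
  ultimately have "h ` (K #>\<^bsub>A\<^esub> a) = {h a}"
    unfolding r_coset_def by (simp add: image_UN)
  then show ?thesis by (simp add: quot_map_def)
qed

lemma quot_map_hom:
  assumes "K \<lhd> A" "group H" "h \<in> hom A H" "K \<subseteq> kernel A H h"
  shows "quot_map h \<in> hom (A Mod K) H"
proof -
  interpret K: normal K A by fact
  note q = quot_map_coset[OF assms]
  show ?thesis
  proof (rule homI)
    fix X Y assume "X \<in> carrier (A Mod K)" "Y \<in> carrier (A Mod K)"
    then obtain x y where "x \<in> carrier A" "X = K #>\<^bsub>A\<^esub> x" "y \<in> carrier A" "Y = K #>\<^bsub>A\<^esub> y"
      by (auto simp: carrier_FactGroup)
    then show "quot_map h (X \<otimes>\<^bsub>A Mod K\<^esub> Y) = quot_map h X \<otimes>\<^bsub>H\<^esub> quot_map h Y"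
      using assms(3) by (simp add: K.rcos_sum q hom_mult)
  qed (use assms(3) q in \<open>auto simp: carrier_FactGroup hom_in_carrier\<close>)
qed

text \<open>The first isomorphism theorem, in the form in which it is used for \<open>chi_m\<close>
  and for the universal coefficient map.\<close>

lemma quot_map_iso:
  assumes "group A" "group H" "h \<in> hom A H" "kernel A H h = K" "h ` carrier A = carrier H"
  shows "quot_map h \<in> iso (A Mod K) H"
proof -
  interpret group_hom A H h
    using assms by (simp add: group_hom_def group_hom_axioms_def)
  have "quot_map h = (\<lambda>X. the_elem (h ` X))" by (simp add: quot_map_def fun_eq_iff)
  then show ?thesis using FactGroup_iso_set assms(4,5) by simp
qed

lemma coset_hom:
  assumes "comm_group B" "subgroup N B" "\<psi> \<in> hom A B"
  shows "(\<lambda>a. N #>\<^bsub>B\<^esub> \<psi> a) \<in> hom A (B Mod N)"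
proof -
  interpret B: comm_group B by fact
  interpret N: normal N B by (rule B.subgroup_imp_normal) fact
  show ?thesis
    using hom_compose[OF assms(3) N.r_coset_hom_Mod] by (simp add: comp_def)
qed

text \<open>The class of an element of \<open>B\<close> is trivial exactly when the element lies in
  \<open>N\<close>, because it belongs to its own coset.\<close>

lemma kernel_coset_map:
  assumes "comm_group B" "subgroup N B" "\<psi> \<in> hom A B"
  shows "kernel A (B Mod N) (\<lambda>a. N #>\<^bsub>B\<^esub> \<psi> a) = {a \<in> carrier A. \<psi> a \<in> N}"
proof -
  interpret B: comm_group B by fact
  interpret N: subgroup N B by fact
  have "N #>\<^bsub>B\<^esub> b = N \<longleftrightarrow> b \<in> N" if "b \<in> carrier B" for b
    using that N.rcos_const[OF B.is_group] B.rcos_self[OF that assms(2)] by auto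
  then show ?thesis using assms(3) by (auto simp: kernel_def hom_in_carrier cong: conj_cong)
qed

text \<open>Since \<open>\<psi>\<close> is injective, the preimage of \<open>N = \<psi> K\<close> is
  no larger than \<open>K\<close>, so the composite with the projection has kernel \<open>K\<close>.
  This serves both \<open>iota_m\<close> and \<open>zeta_m\<close>.\<close>

lemma quot_map_iso_of_iso:
  assumes A: "group A" and B: "comm_group B" and K: "subgroup K A" and \<psi>: "\<psi> \<in> iso A B"
    and N: "\<psi> ` K = N"
  shows "quot_map (\<lambda>a. N #>\<^bsub>B\<^esub> \<psi> a) \<in> iso (A Mod K) (B Mod N)"
    and "\<And>a. a \<in> carrier A \<Longrightarrow> quot_map (\<lambda>a. N #>\<^bsub>B\<^esub> \<psi> a) (K #>\<^bsub>A\<^esub> a) = N #>\<^bsub>B\<^esub> \<psi> a"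
proof -
  interpret A: group A by fact
  interpret B: comm_group B by fact
  have hom: "\<psi> \<in> hom A B" and bij: "bij_betw \<psi> (carrier A) (carrier B)"
    using \<psi> by (auto simp: iso_def)
  have KA: "K \<subseteq> carrier A" using K by (rule subgroup.subset)
  interpret \<psi>: group_hom A B \<psi> by unfold_locales (rule hom)
  have NB: "subgroup N B" using \<psi>.subgroup_img_is_subgroup[OF K] N by simp
  let ?h = "\<lambda>a. N #>\<^bsub>B\<^esub> \<psi> a"
  have ker: "kernel A (B Mod N) ?h = K"
    unfolding kernel_coset_map[OF B NB hom] using bij KA N
    by (auto simp: bij_betw_def inj_on_def)
  have h: "?h \<in> hom A (B Mod N)" by (rule coset_hom) fact+
  have grp: "group (B Mod N)"
    using B.abelian_FactGroup[OF NB] by (rule comm_group.axioms)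
  have "?h ` carrier A = carrier (B Mod N)"
    using bij unfolding bij_betw_def carrier_FactGroup by (metis image_image)
  then show "quot_map ?h \<in> iso (A Mod K) (B Mod N)"
    using quot_map_iso[OF A grp h ker] by simp
  interpret h: group_hom A "B Mod N" ?h
    using h grp A by (simp add: group_hom_def group_hom_axioms_def)
  show "quot_map ?h (K #>\<^bsub>A\<^esub> a) = ?h a" if "a \<in> carrier A" for a
    using quot_map_coset[OF _ grp h _ that, of K] h.normal_kernel ker by simp
qed


section \<open>Chain and cochain groups\<close>

lemma comm_group_subgrp: "comm_group A \<Longrightarrow> subgroup S A \<Longrightarrow> comm_group (subgrp A S)"
  unfolding subgrp_def
  by (rule group.group_comm_groupI)
     (auto intro!: subgroup.subgroup_is_group comm_monoid.m_comm simp: comm_group_def dest: subgroup.mem_carrier)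

lemma subgrp_simps [simp]:
  "carrier (subgrp A S) = S" "x \<otimes>\<^bsub>subgrp A S\<^esub> y = x \<otimes>\<^bsub>A\<^esub> y" "\<one>\<^bsub>subgrp A S\<^esub> = \<one>\<^bsub>A\<^esub>"
  by (simp_all add: subgrp_def)

lemma comm_group_DirProd: "comm_group A \<Longrightarrow> comm_group B \<Longrightarrow> comm_group (A \<times>\<times> B)"
  by (rule group.group_comm_groupI)
     (auto simp: DirProd_group comm_group.axioms(2) comm_group_def comm_monoid.m_comm)

lemma cochains_simps [simp]:
  "carrier (cochains S) = extensional S"
  "f \<otimes>\<^bsub>cochains S\<^esub> g = (\<lambda>s\<in>S. f s + g s)"
  "\<one>\<^bsub>cochains S\<^esub> = (\<lambda>s\<in>S. 0)"
  by (simp_all add: cochains_def PiE_def)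

lemma comm_group_cochains: "comm_group (cochains S)"
proof (rule group.group_comm_groupI)
  show "group (cochains S)" by (simp add: cochains_def)
qed (auto simp: add.commute)

lemma dual_group_simps [simp]:
  "carrier (dual_group M) = hom M integer_group \<inter> extensional (carrier M)"
  "\<phi> \<otimes>\<^bsub>dual_group M\<^esub> \<psi> = (\<lambda>x\<in>carrier M. \<phi> x + \<psi> x)"
  "\<one>\<^bsub>dual_group M\<^esub> = (\<lambda>x\<in>carrier M. 0)"
  by (simp_all add: dual_group_def)

lemma comm_group_dual_group:
  assumes "group M"
  shows "comm_group (dual_group M)"
proof (rule comm_groupI)
  interpret M: group M by fact
  fix \<phi> assume \<phi>: "\<phi> \<in> carrier (dual_group M)"
  show "\<one>\<^bsub>dual_group M\<^esub> \<otimes>\<^bsub>dual_group M\<^esub> \<phi> = \<phi>"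
    using \<phi> by (auto intro!: extensionalityI[of _ "carrier M"])
  have "(\<lambda>x\<in>carrier M. - \<phi> x) \<in> carrier (dual_group M)"
    using \<phi> by (auto simp: hom_def)
  then show "\<exists>\<psi>\<in>carrier (dual_group M). \<psi> \<otimes>\<^bsub>dual_group M\<^esub> \<phi> = \<one>\<^bsub>dual_group M\<^esub>"
    by (rule bexI[rotated]) auto
qed (use assms in \<open>auto simp: hom_def group.is_monoid monoid.m_closed\<close>)

text \<open>Additivity in subtractive form, to match the induction on chains by differences. The
  equation for \<open>x\<close> replaces the computation of an inverse in \<open>M\<close>.\<close>

lemma hom_integer_diff:
  assumes "group M" "\<phi> \<in> hom M integer_group" "x \<in> carrier M" "y \<in> carrier M" "z \<in> carrier M"
    "x = z \<otimes>\<^bsub>M\<^esub> y"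
  shows "\<phi> z = \<phi> x - \<phi> y"
  using hom_mult[OF assms(2,5,4)] assms(6) by simp

section \<open>The coefficient map from chains to cochains\<close>

lemma chain_to_cochain_diff:
  "chain_to_cochain S (a - b) = (\<lambda>s\<in>S. chain_to_cochain S a s - chain_to_cochain S b s)"
  by (auto simp: chain_to_cochain_def lookup_minus)

text \<open>Outside \<open>S\<close> all coefficients vanish, so the restriction to \<open>S\<close>
  loses nothing.\<close>

lemma chain_to_cochain_inj:
  "Poly_Mapping.keys a \<subseteq> S \<Longrightarrow> Poly_Mapping.keys b \<subseteq> S \<Longrightarrow>
    chain_to_cochain S a = chain_to_cochain S b \<Longrightarrow> a = b"
  unfolding chain_to_cochain_def fun_eq_iff restrict_def
  by (rule poly_mapping_eqI) (metis in_keys_iff subsetD)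

lemma chain_to_cochain_surj:
  assumes "finite S" "f \<in> extensional S"
  obtains c where "Poly_Mapping.keys c \<subseteq> S" "chain_to_cochain S c = f"
proof
  \<comment> \<open>Extension by 0 outside \<open>S\<close> has finite support because
    \<open>S\<close> is finite, so it really is the coefficient function of a chain.\<close>
  let ?c = "Abs_poly_mapping (\<lambda>s. if s \<in> S then f s else 0)"
  have l: "Poly_Mapping.lookup ?c = (\<lambda>s. if s \<in> S then f s else 0)"
    by (rule Abs_poly_mapping_inverse) (use assms in \<open>auto intro: finite_subset[of _ S]\<close>)
  show "Poly_Mapping.keys ?c \<subseteq> S" by (auto simp: in_keys_iff l split: if_splits)
  show "chain_to_cochain S ?c = f"
    using assms by (auto simp: chain_to_cochain_def l extensional_def)
qed

section \<open>Linearity of evaluation and degree, and supports of chains\<close>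

lemma chain_eval_restrict [simp]:
  "Poly_Mapping.keys c \<subseteq> S \<Longrightarrow> chain_eval (restrict f S) c = chain_eval f c"
  unfolding chain_eval_def by (rule sum.cong) (metis restrict_apply' subsetD)+

lemma chain_eval_add_left: "chain_eval (\<lambda>x. f x + g x) c = chain_eval f c + chain_eval g c"
  by (simp add: chain_eval_def algebra_simps sum.distrib)

lemma chain_eval_zero [simp]: "chain_eval f 0 = 0"
  by (simp add: chain_eval_def)

lemma chain_eval_frag_of [simp]: "chain_eval f (frag_of s) = f s"
  by (simp add: chain_eval_def)

lemma chain_eval_cmul [simp]: "chain_eval f (frag_cmul k c) = k * chain_eval f c"
  using keys_cmul[of k c]
  by (simp add: chain_eval_conv[of "Poly_Mapping.keys c"] sum_distrib_left mult.assoc)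

lemma chain_degree_simps [simp]:
  "chain_degree 0 = 0" "chain_degree (frag_of s) = 1"
  by (simp_all add: chain_degree_def)

lemma chain_degree_cmul [simp]: "chain_degree (frag_cmul k c) = k * chain_degree c"
  using chain_eval_cmul[of "\<lambda>_. 1" k c] by (simp add: chain_eval_def chain_degree_def)

lemma chain_degree_add: "chain_degree (a + b) = chain_degree a + chain_degree b"
  using chain_degree_diff[of "a + b" b] by simp

text \<open>Both sides are the sum over \<open>S\<close> of the products of coefficients, the
  standard symmetric form on chains. This symmetry is what computes the transpose of the coefficient
  map later.\<close>

lemma chain_eval_chain_to_cochain_commute:
  assumes "finite S" "Poly_Mapping.keys a \<subseteq> S" "Poly_Mapping.keys b \<subseteq> S"
  shows "chain_eval (chain_to_cochain S a) b = chain_eval (chain_to_cochain S b) a"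
  using assms by (simp add: chain_eval_conv[of S] chain_to_cochain_def mult.commute)

lemma keys_frag_extend_subset:
  "(\<And>x. x \<in> Poly_Mapping.keys c \<Longrightarrow> Poly_Mapping.keys (f x) \<subseteq> S) \<Longrightarrow> Poly_Mapping.keys (frag_extend f c) \<subseteq> S"
  by (intro order_trans[OF keys_frag_extend] UN_least)

lemma keys_diff_subset:
  "Poly_Mapping.keys a \<subseteq> S \<Longrightarrow> Poly_Mapping.keys b \<subseteq> S \<Longrightarrow> Poly_Mapping.keys (a - b) \<subseteq> S"
  by (rule order_trans[OF keys_diff Un_least])

lemma keys_add_subset:
  "Poly_Mapping.keys a \<subseteq> S \<Longrightarrow> Poly_Mapping.keys b \<subseteq> S \<Longrightarrow> Poly_Mapping.keys (a + b) \<subseteq> S"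
  by (rule order_trans[OF keys_add Un_least])


section \<open>Boundary maps of a finite graph\<close>

lemma boundary_simps [simp]:
  "boundary G 0 = 0" "boundary G (frag_of e) = frag_of (head G e) - frag_of (tail G e)"
  "boundary G (a - b) = boundary G a - boundary G b" "boundary G (a + b) = boundary G a + boundary G b"
  "boundary G (- a) = - boundary G a"
  by (simp_all add: boundary_def frag_extend_diff frag_extend_add frag_extend_minus)

lemma boundary_adj_simps [simp]:
  "boundary_adj G 0 = 0" "boundary_adj G (a - b) = boundary_adj G a - boundary_adj G b"
  "boundary_adj G (a + b) = boundary_adj G a + boundary_adj G b"
  by (simp_all add: boundary_adj_def frag_extend_diff frag_extend_add)

lemma rho_pull_chain_simps [simp]:
  "rho_pull_chain I \<rho> 0 = 0" "rho_pull_chain I \<rho> (a - b) = rho_pull_chain I \<rho> a - rho_pull_chain I \<rho> b"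
  "rho_pull_chain I \<rho> (a + b) = rho_pull_chain I \<rho> a + rho_pull_chain I \<rho> b"
  by (simp_all add: rho_pull_chain_def frag_extend_diff frag_extend_add)

lemma chain_degree_boundary [simp]: "chain_degree (boundary G c) = 0"
  using subset_UNIV[of "Poly_Mapping.keys c"]
  by (induction c rule: frag_induction) (simp_all add: chain_degree_diff)

text \<open>The discrete Stokes formula; by linearity it is enough to check it on one arc.\<close>

lemma chain_eval_diff_boundary:
  assumes "Poly_Mapping.keys c \<subseteq> arcs G"
  shows "chain_eval (diff G f) c = chain_eval f (boundary G c)"
  using assms
  by (induction c rule: frag_induction) (simp_all add: chain_eval_diff diff_def)

text \<open>The Stokes formula on the added edges: each runs from \<open>\<star>\<close>, where the
  value is \<open>a\<close>, to \<open>\<rho> i\<close>, so \<open>a\<close> is subtracted once for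
  every unit of degree.\<close>

lemma chain_eval_push:
  "chain_eval (\<lambda>i. f (\<rho> i) - a) b = chain_eval f (frag_extend (\<lambda>i. frag_of (\<rho> i)) b) - a * chain_degree b"
  using subset_UNIV[of "Poly_Mapping.keys b"]
proof (induction b rule: frag_induction)
  case (diff x y)
  then show ?case
    by (simp add: chain_eval_diff frag_extend_diff chain_degree_diff algebra_simps)
qed simp_all

lemma lookup_sum_frag_of:
  assumes "finite S"
  shows "Poly_Mapping.lookup (\<Sum>x\<in>S. frag_of x) y = (if y \<in> S then 1 else 0)"
  using assms by (induction S rule: finite_induct) (auto simp: lookup_add lookup_frag_of)

lemma lookup_rho_pull_chain:
  assumes "finite I" "i \<in> I"
  shows "Poly_Mapping.lookup (rho_pull_chain I \<rho> x) i = Poly_Mapping.lookup x (\<rho> i)"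
  using subset_UNIV[of "Poly_Mapping.keys x"]
proof (induction x rule: frag_induction)
  case (one v)
  show ?case using assms by (auto simp: rho_pull_chain_def lookup_sum_frag_of lookup_frag_of)
qed (simp_all add: lookup_minus)

lemma keys_rho_pull_chain: "Poly_Mapping.keys (rho_pull_chain I \<rho> x) \<subseteq> I"
proof -
  have "Poly_Mapping.keys (\<Sum>i | i \<in> I \<and> \<rho> i = v. frag_of i) \<subseteq> I" for v
    using keys_sum[of frag_of "{i. i \<in> I \<and> \<rho> i = v}"] by auto
  then show ?thesis unfolding rho_pull_chain_def by (rule keys_frag_extend_subset)
qed

text \<open>A vertex contributes 1 at \<open>e\<close> if it is the head and -1 if it is the tail,
  so a loop cancels. In coefficients this is the formula for \<open>diff\<close>.\<close>

lemma lookup_boundary_adj: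
  assumes "finite (arcs G)" "e \<in> arcs G"
  shows "Poly_Mapping.lookup (boundary_adj G x) e = Poly_Mapping.lookup x (head G e) - Poly_Mapping.lookup x (tail G e)"
  using subset_UNIV[of "Poly_Mapping.keys x"]
proof (induction x rule: frag_induction)
  case (one v)
  show ?case using assms by (auto simp: boundary_adj_def lookup_minus lookup_sum_frag_of lookup_frag_of)
qed (simp_all add: lookup_minus)

lemma sum_chain_to_cochain_frag_of:
  assumes "finite S" "s \<in> S"
  shows "(\<Sum>x | x \<in> S \<and> P x. chain_to_cochain S (frag_of s) x) = (if P s then 1 else 0)"
proof -
  have "(\<Sum>x | x \<in> S \<and> P x. chain_to_cochain S (frag_of s) x) = (\<Sum>x | x \<in> S \<and> P x. if x = s then 1 else 0)"
    by (rule sum.cong) (auto simp: chain_to_cochain_def lookup_frag_of)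
  then show ?thesis using assms by (simp add: sum.delta)
qed

text \<open>Both sides are additive in \<open>c\<close>, and on a single arc both give the indicator
  of its head minus the indicator of its tail.\<close>

lemma chain_to_cochain_boundary:
  assumes fin: "finite (arcs G)" and "Poly_Mapping.keys c \<subseteq> arcs G"
  shows "chain_to_cochain (verts G) (boundary G c) = diff_adj G (chain_to_cochain (arcs G) c)"
  using assms(2)
proof (induction c rule: frag_induction)
  case zero
  show ?case by (simp add: diff_adj_def chain_to_cochain_def cong: restrict_cong)
next
  case (one e)
  then show ?case
    unfolding diff_adj_def
    by (intro ext)
       (simp add: sum_chain_to_cochain_frag_of[OF fin] chain_to_cochain_diff restrict_def,
        simp add: chain_to_cochain_def)
next
  case (diff a b)
  then show ?case
    by (auto simp: chain_to_cochain_diff diff_adj_def sum_subtractf intro!: restrict_ext)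
qed

text \<open>The same comparison for the edges leaving \<open>\<star>\<close>: a single
  \<open>i\<close> gives the indicator of \<open>\<rho> i\<close> on both sides.\<close>

lemma chain_to_cochain_push:
  assumes fin: "finite I" and "Poly_Mapping.keys b \<subseteq> I" "v \<in> V"
  shows "chain_to_cochain V (frag_extend (\<lambda>i. frag_of (\<rho> i)) b) v = rho_push_cochain I \<rho> (chain_to_cochain I b) v"
  using assms(2)
proof (induction b rule: frag_induction)
  case zero
  show ?case using assms by (simp add: rho_push_cochain_def chain_to_cochain_def)
next
  case (one i)
  then show ?case
    using sum_chain_to_cochain_frag_of[OF fin, of i "\<lambda>i. \<rho> i = v"] assms
    by (simp add: rho_push_cochain_def) (auto simp: chain_to_cochain_def lookup_frag_of)
next
  case (diff a b)
  then show ?case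
    using assms by (simp add: chain_to_cochain_diff frag_extend_diff rho_push_cochain_def sum_subtractf)
qed

lemma sum_chain_to_cochain:
  "finite S \<Longrightarrow> Poly_Mapping.keys b \<subseteq> S \<Longrightarrow> sum (chain_to_cochain S b) S = chain_degree b"
  by (simp add: chain_degree_conv chain_to_cochain_def)

section \<open>Laplacians in coefficients, and chains made of paths\<close>

context fin_digraph
begin

lemma keys_boundary: "Poly_Mapping.keys c \<subseteq> arcs G \<Longrightarrow> Poly_Mapping.keys (boundary G c) \<subseteq> verts G"
  unfolding boundary_def by (intro keys_frag_extend_subset keys_diff_subset) auto

lemma chain_to_cochain_boundary_adj:
  "chain_to_cochain (arcs G) (boundary_adj G x) = diff G (chain_to_cochain (verts G) x)"
  by (auto simp: chain_to_cochain_def diff_def lookup_boundary_adj intro!: restrict_ext)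

lemma chain_to_cochain_laplace:
  "chain_to_cochain (verts G) (laplace_chain G x) = laplace_cochain G (chain_to_cochain (verts G) x)"
  unfolding laplace_chain_def laplace_cochain_def
  by (simp add: chain_to_cochain_boundary keys_boundary_adj chain_to_cochain_boundary_adj)

text \<open>Connectedness means reachability in the symmetrised graph. Along such a walk an arc is
  added when it is walked forwards and subtracted when it is walked backwards.\<close>

lemma path_chain_exists:
  assumes conn: "connected G" and u: "u \<in> verts G" and v: "v \<in> verts G"
  shows "\<exists>c. Poly_Mapping.keys c \<subseteq> arcs G \<and> boundary G c = frag_of v - frag_of u"
proof -
  have "(u, v) \<in> rtrancl_on (verts G) (parcs (mk_symmetric G))"
    using conn u v by (auto simp: connected_def strongly_connected_def reachable_def)
  then show ?thesis
  proof (induction u v rule: rtrancl_on.induct)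
    case (rtrancl_on_refl u)
    show ?case by (rule exI[of _ 0]) simp
  next
    case (rtrancl_on_into_rtrancl_on u x y)
    from rtrancl_on_into_rtrancl_on.IH obtain c
      where c: "Poly_Mapping.keys c \<subseteq> arcs G" "boundary G c = frag_of x - frag_of u"
      by (elim exE conjE)
    from rtrancl_on_into_rtrancl_on(2) obtain e where e: "e \<in> arcs G" and
      "(x, y) = (tail G e, head G e) \<or> (x, y) = (head G e, tail G e)"
      by (auto simp: parcs_mk_symmetric)
    then have "boundary G (c + frag_of e) = frag_of y - frag_of u
      \<or> boundary G (c - frag_of e) = frag_of y - frag_of u"
      using c(2) by auto
    moreover have "Poly_Mapping.keys (c + frag_of e) \<subseteq> arcs G" "Poly_Mapping.keys (c - frag_of e) \<subseteq> arcs G"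
      using c(1) e by (simp_all add: keys_add_subset keys_diff_subset)
    ultimately show ?case by blast
  qed
qed

lemma paths_from:
  assumes "connected G" "u \<in> verts G"
  obtains p where "\<And>v. v \<in> verts G \<Longrightarrow> Poly_Mapping.keys (p v) \<subseteq> arcs G"
    "\<And>v. v \<in> verts G \<Longrightarrow> boundary G (p v) = frag_of v - frag_of u"
  using path_chain_exists[OF assms] by metis

text \<open>All paths start at \<open>u\<close>, so the starting points add up to the degree of
  \<open>x\<close> at \<open>u\<close>.\<close>

lemma boundary_frag_extend_paths:
  assumes p: "\<And>v. v \<in> verts G \<Longrightarrow> boundary G (p v) = frag_of v - frag_of u"
    and "Poly_Mapping.keys x \<subseteq> verts G"
  shows "boundary G (frag_extend p x) = x - frag_cmul (chain_degree x) (frag_of u)"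
  using assms(2)
proof (induction x rule: frag_induction)
  case (diff a b)
  then show ?case
    by (simp add: frag_extend_diff chain_degree_diff frag_cmul_diff_distrib)
qed (use p in simp_all)

text \<open>Replacing each vertex of \<open>x\<close> by a path leading to it gives a chain whose
  boundary differs from \<open>x\<close> only at the common starting point, by the degree, which is
  0.\<close>

lemma boundary_surj_degree_0:
  assumes "connected G" "Poly_Mapping.keys x \<subseteq> verts G" "chain_degree x = 0"
  obtains c where "Poly_Mapping.keys c \<subseteq> arcs G" "boundary G c = x"
proof -
  obtain u where u: "u \<in> verts G" using assms(1) by (auto simp: connected_def strongly_connected_def)
  obtain p where p: "\<And>v. v \<in> verts G \<Longrightarrow> Poly_Mapping.keys (p v) \<subseteq> arcs G"
    "\<And>v. v \<in> verts G \<Longrightarrow> boundary G (p v) = frag_of v - frag_of u"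
    using paths_from[OF assms(1) u] by blast
  show ?thesis
  proof (rule that)
    show "Poly_Mapping.keys (frag_extend p x) \<subseteq> arcs G"
      using p(1) assms(2) by (intro keys_frag_extend_subset) auto
    show "boundary G (frag_extend p x) = x"
      using boundary_frag_extend_paths[OF p(2) assms(2)] assms(3) by simp
  qed
qed

end


section \<open>The class groups\<close>

lemma img_subgroup:
  assumes "group A" "group B" "h \<in> hom A B"
  shows "subgroup (h ` carrier A) B"
proof -
  interpret group_hom A B h using assms by (simp add: group_hom_def group_hom_axioms_def)
  show ?thesis by (rule img_is_subgroup)
qed

lemmas group_cochains = comm_group.axioms(2)[OF comm_group_cochains]

lemma chain_degree_minus: "chain_degree (- a) = - chain_degree a"
  using chain_degree_diff[of 0 a] by simp

lemma degree_0_subgroup: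
  "subgroup {x \<in> carrier (free_Abelian_group S). chain_degree x = 0} (free_Abelian_group S)"
proof (rule group.subgroupI)
  show "{x \<in> carrier (free_Abelian_group S). chain_degree x = 0} \<noteq> {}"
    by (auto intro: exI[of _ 0])
qed (auto simp: chain_degree_minus chain_degree_add keys_add_subset)

lemma diff_adj_hom: "diff_adj G \<in> hom (cochains (arcs G)) (cochains (verts G))"
proof (rule homI)
  fix f g :: "_ \<Rightarrow> int"
  show "diff_adj G (f \<otimes>\<^bsub>cochains (arcs G)\<^esub> g) = diff_adj G f \<otimes>\<^bsub>cochains (verts G)\<^esub> diff_adj G g"
    by (auto simp: diff_adj_def sum.distrib intro!: restrict_ext)
qed (simp add: diff_adj_def)

locale graph_with_modulus = fin_digraph G for G :: "('v, 'e) pre_digraph" +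
  fixes I :: "'i set" and \<rho> :: "'i \<Rightarrow> 'v"
  assumes conn: "connected G" and fin_I: "finite I" and I_ne: "I \<noteq> {}" and rho: "\<rho> \<in> I \<rightarrow> verts G"
begin

lemma rho_in_verts [simp]: "i \<in> I \<Longrightarrow> \<rho> i \<in> verts G"
  using rho by auto

lemma comm_group_Cl_amb: "comm_group (Cl_amb G I)"
  unfolding Cl_amb_def
  by (intro comm_group_DirProd comm_group_subgrp abelian_free_Abelian_group degree_0_subgroup)

lemma comm_group_Clhat_amb: "comm_group (Clhat_amb G I)"
  unfolding Clhat_amb_def
  by (intro comm_group_DirProd comm_group_subgrp comm_group_cochains img_subgroup diff_adj_hom group_cochains)

lemma Cl_amb_simps [simp]:
  "(x, b) \<in> carrier (Cl_amb G I) \<longleftrightarrow> Poly_Mapping.keys x \<subseteq> verts G \<and> chain_degree x = 0 \<and> Poly_Mapping.keys b \<subseteq> I"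
  "(x, b) \<otimes>\<^bsub>Cl_amb G I\<^esub> (y, c) = (x + y, b + c)"
  by (auto simp: Cl_amb_def)

lemma Clhat_amb_simps [simp]:
  "(f, g) \<in> carrier (Clhat_amb G I) \<longleftrightarrow> f \<in> diff_adj G ` extensional (arcs G) \<and> g \<in> extensional I"
  "(f, g) \<otimes>\<^bsub>Clhat_amb G I\<^esub> (f', g') = (\<lambda>v\<in>verts G. f v + f' v, \<lambda>i\<in>I. g i + g' i)"
  by (auto simp: Clhat_amb_def)

text \<open>A Laplacian is a boundary and hence has degree 0, so the relations are the image of a
  homomorphism into \<open>Cl_amb\<close>.\<close>

lemma Cl_rel_subgroup: "subgroup (Cl_rel G I \<rho>) (Cl_amb G I)"
  unfolding Cl_rel_def
proof (intro img_subgroup homI)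
  show "group (Cl_amb G I)" by (rule comm_group.axioms(2)[OF comm_group_Cl_amb])
  show "(laplace_chain G x, rho_pull_chain I \<rho> x) \<in> carrier (Cl_amb G I)" for x
    by (simp add: keys_rho_pull_chain laplace_chain_def keys_boundary keys_boundary_adj)
qed (simp_all add: laplace_chain_def)

abbreviation cl_cochain :: "('v \<Rightarrow>\<^sub>0 int) \<times> ('i \<Rightarrow>\<^sub>0 int) \<Rightarrow> ('v \<Rightarrow> int) \<times> ('i \<Rightarrow> int)" where
  "cl_cochain \<equiv> \<lambda>(x, b). (chain_to_cochain (verts G) x, chain_to_cochain I b)"

text \<open>Coefficients are bijective on finite sets, so only the vertex summands need an argument.
  By connectedness the chains of degree 0 are exactly the boundaries, and coefficients turn
  boundaries into the image of \<open>diff_adj\<close>.\<close>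

lemma cl_cochain_iso: "cl_cochain \<in> iso (Cl_amb G I) (Clhat_amb G I)"
  unfolding iso_def bij_betw_def
proof (intro CollectI conjI homI inj_onI subset_antisym subsetI)
  have in_Clhat: "cl_cochain z \<in> carrier (Clhat_amb G I)" if z: "z \<in> carrier (Cl_amb G I)" for z
  proof -
    obtain x b where zx: "z = (x, b)" by force
    obtain c where c: "Poly_Mapping.keys c \<subseteq> arcs G" "boundary G c = x"
      using z zx boundary_surj_degree_0[OF conn, of x] by auto
    have "chain_to_cochain (verts G) x = diff_adj G (chain_to_cochain (arcs G) c)"
      using chain_to_cochain_boundary[OF finite_arcs c(1)] c(2) by simp
    then show ?thesis by (auto simp: zx chain_to_cochain_def)
  qed
  show "cl_cochain z \<in> carrier (Clhat_amb G I)" if "z \<in> carrier (Cl_amb G I)" for z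
    by (rule in_Clhat[OF that])
  show "y \<in> carrier (Clhat_amb G I)" if "y \<in> cl_cochain ` carrier (Cl_amb G I)" for y
    using that in_Clhat by blast
  show "cl_cochain (z \<otimes>\<^bsub>Cl_amb G I\<^esub> z') = cl_cochain z \<otimes>\<^bsub>Clhat_amb G I\<^esub> cl_cochain z'" for z z'
    by (cases z; cases z') (auto simp: chain_to_cochain_def lookup_add intro!: restrict_ext)
  show "z = z'" if "z \<in> carrier (Cl_amb G I)" "z' \<in> carrier (Cl_amb G I)" "cl_cochain z = cl_cochain z'" for z z'
    using that chain_to_cochain_inj[of "fst z" "verts G" "fst z'"] chain_to_cochain_inj[of "snd z" I "snd z'"]
    by (cases z; cases z') simp
  show "y \<in> cl_cochain ` carrier (Cl_amb G I)" if y: "y \<in> carrier (Clhat_amb G I)" for y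
  proof -
    obtain \<omega> g where \<omega>: "y = (diff_adj G \<omega>, g)" "\<omega> \<in> extensional (arcs G)" "g \<in> extensional I"
      using y by (cases y) auto
    obtain c where c: "Poly_Mapping.keys c \<subseteq> arcs G" "chain_to_cochain (arcs G) c = \<omega>"
      using chain_to_cochain_surj[OF finite_arcs \<omega>(2)] .
    obtain b where b: "Poly_Mapping.keys b \<subseteq> I" "chain_to_cochain I b = g"
      using chain_to_cochain_surj[OF fin_I \<omega>(3)] .
    have "cl_cochain (boundary G c, b) = y"
      using b c \<omega>(1) by (simp add: chain_to_cochain_boundary)
    moreover have "(boundary G c, b) \<in> carrier (Cl_amb G I)"
      using b c by (simp add: keys_boundary)
    ultimately show ?thesis by blast
  qed
qed

lemma chain_to_cochain_rho_pull:
  "chain_to_cochain I (rho_pull_chain I \<rho> x) = (\<lambda>i\<in>I. chain_to_cochain (verts G) x (\<rho> i))"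
  by (auto simp: chain_to_cochain_def lookup_rho_pull_chain fin_I intro!: restrict_ext)

text \<open>Every cochain on the finite vertex set is the coefficient function of a chain, so both
  sets of relations can be indexed by chains; coefficients commute with the Laplacian and with the
  pullback along \<open>\<rho>\<close>.\<close>

lemma cl_cochain_Cl_rel: "cl_cochain ` Cl_rel G I \<rho> = Clhat_rel G I \<rho>"
proof -
  have "carrier (cochains (verts G)) = chain_to_cochain (verts G) ` carrier (free_Abelian_group (verts G))"
  proof (intro subset_antisym subsetI)
    fix f assume "f \<in> carrier (cochains (verts G))"
    then show "f \<in> chain_to_cochain (verts G) ` carrier (free_Abelian_group (verts G))"
      using chain_to_cochain_surj[OF finite_verts, of f] by (metis carrier_free_Abelian_group_iff cochains_simps(1) imageI)
  qed (auto simp: chain_to_cochain_def)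
  then show ?thesis
    unfolding Cl_rel_def Clhat_rel_def
    by (simp add: image_image chain_to_cochain_laplace chain_to_cochain_rho_pull)
qed

text \<open>Transported from \<open>Cl_rel\<close> along \<open>cl_cochain\<close>.\<close>

lemma Clhat_rel_subgroup: "subgroup (Clhat_rel G I \<rho>) (Clhat_amb G I)"
proof -
  interpret group_hom "Cl_amb G I" "Clhat_amb G I" cl_cochain
    using cl_cochain_iso comm_group_Cl_amb comm_group_Clhat_amb
    by (simp add: group_hom_def group_hom_axioms_def iso_def comm_group.axioms)
  show ?thesis using subgroup_img_is_subgroup[OF Cl_rel_subgroup] by (simp add: cl_cochain_Cl_rel)
qed

lemma iota_m_eq: "iota_m G I \<rho> = quot_map (\<lambda>z. Clhat_rel G I \<rho> #>\<^bsub>Clhat_amb G I\<^esub> cl_cochain z)"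
  unfolding iota_m_def Clhat_class_def by (simp add: case_prod_unfold)

lemma iota_m_iso: "iota_m G I \<rho> \<in> iso (Cl G I \<rho>) (Clhat G I \<rho>)"
  and iota_m_coset: "z \<in> carrier (Cl_amb G I) \<Longrightarrow>
    iota_m G I \<rho> (Cl_rel G I \<rho> #>\<^bsub>Cl_amb G I\<^esub> z) = Clhat_class G I \<rho> (cl_cochain z)"
  unfolding iota_m_eq Cl_def Clhat_def Clhat_class_def
  using comm_group_Cl_amb comm_group_Clhat_amb Cl_rel_subgroup cl_cochain_iso cl_cochain_Cl_rel
  by (simp_all add: quot_map_iso_of_iso comm_group.axioms)


section \<open>The Picard group\<close>

lemma comm_group_ext_cochains1: "comm_group (ext_cochains1 G I)"
  unfolding ext_cochains1_def by (intro comm_group_DirProd comm_group_cochains)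

lemma ext_cochains1_simps [simp]:
  "(f, g) \<in> carrier (ext_cochains1 G I) \<longleftrightarrow> f \<in> extensional (arcs G) \<and> g \<in> extensional I"
  "(f, g) \<otimes>\<^bsub>ext_cochains1 G I\<^esub> (f', g') = (\<lambda>e\<in>arcs G. f e + f' e, \<lambda>i\<in>I. g i + g' i)"
  "\<one>\<^bsub>ext_cochains1 G I\<^esub> = (\<lambda>e\<in>arcs G. 0, \<lambda>i\<in>I. 0)"
  by (auto simp: ext_cochains1_def)

lemma ext_coboundaries_subgroup: "subgroup (ext_coboundaries G I \<rho>) (ext_cochains1 G I)"
  unfolding ext_coboundaries_def
proof (intro img_subgroup homI)
  show "group (cochains (verts G) \<times>\<times> integer_group)" by (simp add: DirProd_group group_cochains)
  show "group (ext_cochains1 G I)" by (rule comm_group.axioms(2)[OF comm_group_ext_cochains1])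
qed (auto simp: ext_diff_def diff_def intro!: restrict_ext)

lemma comm_group_ext_coH1: "comm_group (ext_coH1 G I \<rho>)"
  unfolding ext_coH1_def
  by (rule comm_group.abelian_FactGroup[OF comm_group_ext_cochains1 ext_coboundaries_subgroup])

lemma ext_coboundaries_normal: "ext_coboundaries G I \<rho> \<lhd> ext_cochains1 G I"
  by (rule comm_group.subgroup_imp_normal[OF comm_group_ext_cochains1 ext_coboundaries_subgroup])

abbreviation coh_class :: "('e \<Rightarrow> int) \<times> ('i \<Rightarrow> int) \<Rightarrow> (('e \<Rightarrow> int) \<times> ('i \<Rightarrow> int)) set" where
  "coh_class w \<equiv> ext_coboundaries G I \<rho> #>\<^bsub>ext_cochains1 G I\<^esub> w"

lemma carrier_ext_coH1: "carrier (ext_coH1 G I \<rho>) = coh_class ` carrier (ext_cochains1 G I)"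
  by (simp add: ext_coH1_def carrier_FactGroup)

lemma beta_m_hom: "beta_m G I \<rho> \<in> hom (cochains (arcs G)) (ext_coH1 G I \<rho>)"
  unfolding beta_m_def ext_coH1_def
  by (rule coset_hom[OF comm_group_ext_cochains1 ext_coboundaries_subgroup])
     (auto simp: hom_def intro!: restrict_ext)

lemma beta_image_subgroup: "subgroup (beta_m G I \<rho> ` harmonic G) (ext_coH1 G I \<rho>)"
proof -
  interpret d: group_hom "cochains (arcs G)" "cochains (verts G)" "diff_adj G"
    by (simp add: group_hom_def group_hom_axioms_def group_cochains diff_adj_hom)
  interpret b: group_hom "cochains (arcs G)" "ext_coH1 G I \<rho>" "beta_m G I \<rho>"
    by (simp add: group_hom_def group_hom_axioms_def group_cochains beta_m_hom
        comm_group.axioms(2)[OF comm_group_ext_coH1])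
  show ?thesis
    unfolding harmonic_def by (rule b.subgroup_img_is_subgroup[OF d.subgroup_kernel])
qed

lemma comm_group_Clhat: "comm_group (Clhat G I \<rho>)"
  unfolding Clhat_def by (rule comm_group.abelian_FactGroup[OF comm_group_Clhat_amb Clhat_rel_subgroup])

section \<open>The map to the dual class group: kernel and image\<close>

abbreviation pic_cochain :: "('e \<Rightarrow> int) \<times> ('i \<Rightarrow> int) \<Rightarrow> ('v \<Rightarrow> int) \<times> ('i \<Rightarrow> int)" where
  "pic_cochain \<equiv> \<lambda>(\<omega>, h). (diff_adj G \<omega>, h)"

lemma pic_cochain_hom: "pic_cochain \<in> hom (ext_cochains1 G I) (Clhat_amb G I)"
proof (rule homI)
  fix w w' assume "w \<in> carrier (ext_cochains1 G I)" "w' \<in> carrier (ext_cochains1 G I)"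
  then show "pic_cochain (w \<otimes>\<^bsub>ext_cochains1 G I\<^esub> w') = pic_cochain w \<otimes>\<^bsub>Clhat_amb G I\<^esub> pic_cochain w'"
    using hom_mult[OF diff_adj_hom, of _ G] by (cases w; cases w') simp
qed auto

abbreviation chi_pre :: "('e \<Rightarrow> int) \<times> ('i \<Rightarrow> int) \<Rightarrow> (('v \<Rightarrow> int) \<times> ('i \<Rightarrow> int)) set" where
  "chi_pre \<equiv> \<lambda>w. Clhat_rel G I \<rho> #>\<^bsub>Clhat_amb G I\<^esub> pic_cochain w"

lemma chi_m_eq: "chi_m G I \<rho> = quot_map (quot_map chi_pre)"
  unfolding chi_m_def Clhat_class_def by (simp add: case_prod_unfold)

lemma chi_pre_hom: "chi_pre \<in> hom (ext_cochains1 G I) (Clhat G I \<rho>)"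
  unfolding Clhat_def by (rule coset_hom[OF comm_group_Clhat_amb Clhat_rel_subgroup pic_cochain_hom])

lemma chi_pre_kernel:
  "kernel (ext_cochains1 G I) (Clhat G I \<rho>) chi_pre
   = {w \<in> carrier (ext_cochains1 G I). pic_cochain w \<in> Clhat_rel G I \<rho>}"
  unfolding Clhat_def by (rule kernel_coset_map[OF comm_group_Clhat_amb Clhat_rel_subgroup pic_cochain_hom])

lemma diff_cong: "(\<And>v. v \<in> verts G \<Longrightarrow> f v - g v = c) \<Longrightarrow> diff G f = diff G g"
  unfolding diff_def by (rule restrict_ext) (fastforce simp: diff_eq_eq)

text \<open>Shifting \<open>f\<close> by the constant \<open>a\<close> leaves \<open>df\<close> unchanged, so the value at \<open>\<star>\<close> can be absorbed.\<close>

lemma coboundaries_in_kernel: "ext_coboundaries G I \<rho> \<subseteq> kernel (ext_cochains1 G I) (Clhat G I \<rho>) chi_pre"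
proof
  fix w assume w: "w \<in> ext_coboundaries G I \<rho>"
  then obtain f a where fa: "f \<in> extensional (verts G)" "w = (diff G f, \<lambda>i\<in>I. f (\<rho> i) - a)"
    by (auto simp: ext_coboundaries_def ext_diff_def)
  define f' where "f' = (\<lambda>v\<in>verts G. f v - a)"
  have "diff G f' = diff G f" by (rule diff_cong[of _ _ "- a"]) (simp add: f'_def)
  then have "pic_cochain w = (laplace_cochain G f', \<lambda>i\<in>I. f' (\<rho> i))"
    by (auto simp: fa f'_def laplace_cochain_def intro!: restrict_ext)
  moreover have "f' \<in> carrier (cochains (verts G))" by (simp add: f'_def)
  ultimately have "pic_cochain w \<in> Clhat_rel G I \<rho>" unfolding Clhat_rel_def by blast
  then show "w \<in> kernel (ext_cochains1 G I) (Clhat G I \<rho>) chi_pre"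
    unfolding chi_pre_kernel using w subgroup.subset[OF ext_coboundaries_subgroup] by blast
qed

lemma group_Clhat: "group (Clhat G I \<rho>)"
  by (rule comm_group.axioms(2)[OF comm_group_Clhat])

lemmas chi_pre_coset =
  quot_map_coset[OF ext_coboundaries_normal group_Clhat chi_pre_hom coboundaries_in_kernel]

text \<open>If \<open>(\<omega>, h)\<close> becomes trivial, one function \<open>f\<close> accounts
  for both components. Subtracting the coboundary of \<open>f\<close> then leaves
  \<open>(\<eta>, 0)\<close> with \<open>\<eta> = \<omega> - df\<close> harmonic. Conversely
  \<open>diff_adj\<close> kills the harmonic cochains.\<close>

lemma chi_kernel: "kernel (ext_coH1 G I \<rho>) (Clhat G I \<rho>) (quot_map chi_pre) = beta_m G I \<rho> ` harmonic G"
proof (intro subset_antisym subsetI)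
  fix X assume X: "X \<in> kernel (ext_coH1 G I \<rho>) (Clhat G I \<rho>) (quot_map chi_pre)"
  then obtain w where w: "w \<in> carrier (ext_cochains1 G I)" "X = coh_class w"
    by (auto simp: kernel_def carrier_ext_coH1)
  then have "w \<in> kernel (ext_cochains1 G I) (Clhat G I \<rho>) chi_pre"
    using X by (simp add: kernel_def chi_pre_coset)
  then obtain f where f: "f \<in> extensional (verts G)" "pic_cochain w = (laplace_cochain G f, \<lambda>i\<in>I. f (\<rho> i))"
    unfolding chi_pre_kernel by (auto simp: Clhat_rel_def)
  obtain \<omega> h where \<omega>: "w = (\<omega>, h)" "\<omega> \<in> extensional (arcs G)" "h = (\<lambda>i\<in>I. f (\<rho> i))"
    "diff_adj G \<omega> = laplace_cochain G f"
    using w f by (cases w) auto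
  \<comment> \<open>The candidate for the harmonic representative of the class
    \<open>X\<close>.\<close>
  define \<eta> where "\<eta> = (\<lambda>e\<in>arcs G. \<omega> e - diff G f e)"
  have sum: "\<omega> = (\<lambda>e\<in>arcs G. \<eta> e + diff G f e)"
    using \<omega>(2) by (auto simp: \<eta>_def extensional_def)
  have "diff_adj G \<omega> = (\<lambda>v\<in>verts G. diff_adj G \<eta> v + laplace_cochain G f v)"
  proof -
    have "diff_adj G (\<eta> \<otimes>\<^bsub>cochains (arcs G)\<^esub> diff G f)
        = diff_adj G \<eta> \<otimes>\<^bsub>cochains (verts G)\<^esub> diff_adj G (diff G f)"
      by (rule hom_mult[OF diff_adj_hom]) (simp_all add: \<eta>_def diff_def)
    moreover have "\<eta> \<otimes>\<^bsub>cochains (arcs G)\<^esub> diff G f = \<omega>"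
      unfolding cochains_simps by (rule sum[symmetric])
    ultimately show ?thesis by (simp add: laplace_cochain_def)
  qed
  then have zero: "diff_adj G \<eta> v = 0" if "v \<in> verts G" for v
    using that \<omega>(4) by (auto dest: fun_cong[of _ _ v])
  have "diff_adj G \<eta> \<in> extensional (verts G)"
    by (simp add: diff_adj_def)
  then have "diff_adj G \<eta> = (\<lambda>v\<in>verts G. 0)"
    by (rule extensionalityI) (simp_all add: zero)
  then have \<eta>: "\<eta> \<in> harmonic G" by (simp add: harmonic_def kernel_def \<eta>_def)
  \<comment> \<open>The value at \<open>\<star>\<close> is 0 because the second component of
    \<open>w\<close> is \<open>f\<close> composed with \<open>\<rho>\<close>, without a
    shift.\<close>
  have "ext_diff G I \<rho> (f, 0) \<in> ext_coboundaries G I \<rho>"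
    using f(1) by (auto simp: ext_coboundaries_def)
  moreover have "w = ext_diff G I \<rho> (f, 0) \<otimes>\<^bsub>ext_cochains1 G I\<^esub> (\<eta>, \<lambda>i\<in>I. 0)"
    by (subst \<omega>(1), subst sum) (auto simp: \<omega>(3) ext_diff_def intro!: restrict_ext)
  ultimately have "w \<in> coh_class (\<eta>, \<lambda>i\<in>I. 0)" unfolding r_coset_def by blast
  then have "X = beta_m G I \<rho> \<eta>"
    unfolding beta_m_def w(2)
    using comm_group.axioms(2)[OF comm_group_ext_cochains1] ext_coboundaries_subgroup \<eta>_def
    by (metis (no_types, lifting) ext_cochains1_simps(1) group.repr_independence restrict_extensional)
  with \<eta> show "X \<in> beta_m G I \<rho> ` harmonic G" by blast
next
  fix X assume "X \<in> beta_m G I \<rho> ` harmonic G"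
  then obtain \<eta> where \<eta>: "\<eta> \<in> extensional (arcs G)" "diff_adj G \<eta> = (\<lambda>v\<in>verts G. 0)"
    "X = coh_class (\<eta>, \<lambda>i\<in>I. 0)"
    by (auto simp: harmonic_def kernel_def beta_m_def)
  have car: "(\<eta>, \<lambda>i\<in>I. 0) \<in> carrier (ext_cochains1 G I)" using \<eta> by simp
  have one: "pic_cochain (\<eta>, \<lambda>i\<in>I. 0) = \<one>\<^bsub>Clhat_amb G I\<^esub>"
    using \<eta>(2) by (simp add: Clhat_amb_def)
  have "pic_cochain (\<eta>, \<lambda>i\<in>I. 0) \<in> Clhat_rel G I \<rho>"
    unfolding one by (rule subgroup.one_closed[OF Clhat_rel_subgroup])
  then have "(\<eta>, \<lambda>i\<in>I. 0) \<in> kernel (ext_cochains1 G I) (Clhat G I \<rho>) chi_pre"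
    unfolding chi_pre_kernel using car by blast
  then show "X \<in> kernel (ext_coH1 G I \<rho>) (Clhat G I \<rho>) (quot_map chi_pre)"
    using car by (auto simp: kernel_def \<eta>(3) chi_pre_coset carrier_ext_coH1)
qed

text \<open>The first summand of \<open>Clhat_amb\<close> is by definition the image of
  \<open>diff_adj\<close>, and the second is hit by the identity.\<close>

lemma pic_cochain_surj: "pic_cochain ` carrier (ext_cochains1 G I) = carrier (Clhat_amb G I)"
  by (auto simp: ext_cochains1_def Clhat_amb_def image_iff)

lemma chi_surj: "quot_map chi_pre ` carrier (ext_coH1 G I \<rho>) = carrier (Clhat G I \<rho>)"
proof -
  have "carrier (Clhat G I \<rho>) =
      (\<lambda>z. Clhat_rel G I \<rho> #>\<^bsub>Clhat_amb G I\<^esub> z) ` pic_cochain ` carrier (ext_cochains1 G I)"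
    by (simp add: Clhat_def carrier_FactGroup pic_cochain_surj)
  also have "\<dots> = (\<lambda>w. quot_map chi_pre (coh_class w)) ` carrier (ext_cochains1 G I)"
    unfolding image_image by (rule image_cong) (simp_all add: chi_pre_coset)
  finally show ?thesis by (simp add: carrier_ext_coH1 image_image)
qed

lemma chi_hom: "quot_map chi_pre \<in> hom (ext_coH1 G I \<rho>) (Clhat G I \<rho>)"
  unfolding ext_coH1_def
  by (rule quot_map_hom[OF ext_coboundaries_normal group_Clhat chi_pre_hom coboundaries_in_kernel])

lemma chi_m_iso: "chi_m G I \<rho> \<in> iso (Pic G I \<rho>) (Clhat G I \<rho>)"
  unfolding chi_m_eq Pic_def
  by (rule quot_map_iso[OF comm_group.axioms(2)[OF comm_group_ext_coH1] group_Clhat chi_hom chi_kernel chi_surj])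

text \<open>The outer quotient is resolved by \<open>chi_kernel\<close>, the inner one by
  \<open>chi_pre_coset\<close>.\<close>

lemma chi_m_coset:
  assumes "w \<in> carrier (ext_cochains1 G I)"
  shows "chi_m G I \<rho> ((beta_m G I \<rho> ` harmonic G) #>\<^bsub>ext_coH1 G I \<rho>\<^esub> coh_class w) = chi_pre w"
proof -
  have "coh_class w \<in> carrier (ext_coH1 G I \<rho>)" using assms by (auto simp: carrier_ext_coH1)
  then show ?thesis
    unfolding chi_m_eq
    using quot_map_coset[OF comm_group.subgroup_imp_normal[OF comm_group_ext_coH1 beta_image_subgroup]
        group_Clhat chi_hom] chi_kernel chi_pre_coset assms by simp
qed

end


section \<open>The universal coefficient isomorphism\<close>

text \<open>The inverse is precomposition with the inverse of \<open>\<theta>\<close>. Restriction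
  to the carrier keeps the functions extensional.\<close>

lemma dual_iso:
  assumes A: "group A" and B: "group B" and \<theta>: "\<theta> \<in> iso A B"
  shows "(\<lambda>\<phi>. \<lambda>z\<in>carrier A. \<phi> (\<theta> z)) \<in> iso (dual_group B) (dual_group A)"
proof -
  interpret A: group A by fact
  have hom: "\<theta> \<in> hom A B" and bij: "bij_betw \<theta> (carrier A) (carrier B)"
    using \<theta> by (auto simp: iso_def)
  define \<theta>' where "\<theta>' = inv_into (carrier A) \<theta>"
  have hom': "\<theta>' \<in> hom B A" using A.iso_set_sym[OF \<theta>] by (simp add: iso_def \<theta>'_def)
  have inv: "\<theta>' (\<theta> z) = z" if "z \<in> carrier A" for z
    using that bij by (simp add: \<theta>'_def bij_betw_def inv_into_f_f)
  have inv': "\<theta> (\<theta>' y) = y" if "y \<in> carrier B" for y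
    using that bij by (simp add: \<theta>'_def bij_betw_def f_inv_into_f)
  let ?T = "\<lambda>\<phi>. \<lambda>z\<in>carrier A. \<phi> (\<theta> z)"
  have T: "?T \<phi> \<in> carrier (dual_group A)" if "\<phi> \<in> carrier (dual_group B)" for \<phi>
    using that hom by (auto simp: hom_def Pi_iff)
  show ?thesis
    unfolding iso_def bij_betw_def
  proof (intro CollectI conjI homI inj_onI subset_antisym subsetI)
    show "?T \<phi> \<in> carrier (dual_group A)" if "\<phi> \<in> carrier (dual_group B)" for \<phi>
      by (rule T[OF that])
    show "\<psi> \<in> carrier (dual_group A)" if "\<psi> \<in> ?T ` carrier (dual_group B)" for \<psi>
      using that T by blast
    show "?T (\<phi> \<otimes>\<^bsub>dual_group B\<^esub> \<psi>) = ?T \<phi> \<otimes>\<^bsub>dual_group A\<^esub> ?T \<psi>" for \<phi> \<psi>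
      using hom by (auto simp: hom_in_carrier intro!: restrict_ext)
    show "\<phi> = \<psi>" if \<phi>: "\<phi> \<in> carrier (dual_group B)" and \<psi>: "\<psi> \<in> carrier (dual_group B)" and eq: "?T \<phi> = ?T \<psi>"
      for \<phi> \<psi>
    proof (rule extensionalityI[of _ "carrier B"])
      show "\<phi> y = \<psi> y" if y: "y \<in> carrier B" for y
        using fun_cong[OF eq, of "\<theta>' y"] inv'[OF y] hom_in_carrier[OF hom' y] by simp
    qed (use \<phi> \<psi> in auto)
    show "\<psi> \<in> ?T ` carrier (dual_group B)" if \<psi>: "\<psi> \<in> carrier (dual_group A)" for \<psi>
    proof (rule image_eqI)
      show "\<psi> = ?T (\<lambda>y\<in>carrier B. \<psi> (\<theta>' y))"
        using \<psi> hom by (intro extensionalityI[of _ "carrier A"]) (auto simp: inv hom_in_carrier)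
      have "\<psi> \<circ> \<theta>' \<in> hom B integer_group"
        using hom_compose[OF hom'] \<psi> by auto
      then show "(\<lambda>y\<in>carrier B. \<psi> (\<theta>' y)) \<in> carrier (dual_group B)"
        using B by (auto simp: hom_def group.is_monoid monoid.m_closed)
    qed
  qed
qed

lemma ext_eval_simps [simp]: "ext_eval (f, g) (c, b) = chain_eval f c + chain_eval g b"
  by (simp add: ext_eval_def)

section \<open>Cycles of the extended graph and evaluation on them\<close>

context graph_with_modulus
begin

abbreviation push :: "('i \<Rightarrow>\<^sub>0 int) \<Rightarrow> ('v \<Rightarrow>\<^sub>0 int)" where
  "push \<equiv> frag_extend (\<lambda>i. frag_of (\<rho> i))"

lemma keys_push: "Poly_Mapping.keys b \<subseteq> I \<Longrightarrow> Poly_Mapping.keys (push b) \<subseteq> verts G"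
  by (rule keys_frag_extend_subset) auto

lemma chain_degree_push [simp]: "chain_degree (push b) = chain_degree b"
  using subset_UNIV[of "Poly_Mapping.keys b"]
  by (induction b rule: frag_induction) (simp_all add: chain_degree_diff frag_extend_diff)

lemma group_ext_chains1: "group (ext_chains1 G I)"
  unfolding ext_chains1_def by (simp add: DirProd_group)

lemma ext_chains1_simps [simp]:
  "(c, b) \<in> carrier (ext_chains1 G I) \<longleftrightarrow> Poly_Mapping.keys c \<subseteq> arcs G \<and> Poly_Mapping.keys b \<subseteq> I"
  "(c, b) \<otimes>\<^bsub>ext_chains1 G I\<^esub> (c', b') = (c + c', b + b')"
  by (auto simp: ext_chains1_def)

lemma ext_boundary_hom:
  "ext_boundary G \<rho> \<in> hom (ext_chains1 G I) (free_Abelian_group (verts G) \<times>\<times> integer_group)"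
proof (rule homI)
  fix z w assume z: "z \<in> carrier (ext_chains1 G I)" and "w \<in> carrier (ext_chains1 G I)"
  show "ext_boundary G \<rho> z \<in> carrier (free_Abelian_group (verts G) \<times>\<times> integer_group)"
    using z by (cases z) (simp add: ext_boundary_def keys_add_subset keys_boundary keys_push)
  show "ext_boundary G \<rho> (z \<otimes>\<^bsub>ext_chains1 G I\<^esub> w)
      = ext_boundary G \<rho> z \<otimes>\<^bsub>free_Abelian_group (verts G) \<times>\<times> integer_group\<^esub> ext_boundary G \<rho> w"
    by (cases z; cases w) (simp add: ext_boundary_def frag_extend_add chain_degree_add)
qed

abbreviation H1 :: "(('e \<Rightarrow>\<^sub>0 int) \<times> ('i \<Rightarrow>\<^sub>0 int)) monoid" where "H1 \<equiv> ext_H1 G I \<rho>"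
abbreviation Harm :: "(('e \<Rightarrow> int) \<times> ('i \<Rightarrow> int)) monoid" where "Harm \<equiv> ext_harmonic G I \<rho>"

lemma H1_subgroup: "subgroup (carrier H1) (ext_chains1 G I)"
proof -
  interpret group_hom "ext_chains1 G I" "free_Abelian_group (verts G) \<times>\<times> integer_group" "ext_boundary G \<rho>"
    by (simp add: group_hom_def group_hom_axioms_def group_ext_chains1 ext_boundary_hom DirProd_group)
  show ?thesis by (simp add: ext_H1_def subgroup_kernel)
qed

lemma group_H1: "group H1"
  using subgroup.subgroup_is_group[OF H1_subgroup group_ext_chains1] by (simp add: ext_H1_def subgrp_def)

lemma H1_simps [simp]:
  "(c, b) \<in> carrier H1 \<longleftrightarrow> Poly_Mapping.keys c \<subseteq> arcs G \<and> Poly_Mapping.keys b \<subseteq> I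
     \<and> boundary G c + push b = 0 \<and> chain_degree b = 0"
  "(c, b) \<otimes>\<^bsub>H1\<^esub> (c', b') = (c + c', b + b')"
  by (auto simp: ext_H1_def kernel_def ext_boundary_def)

abbreviation uc_pre :: "('e \<Rightarrow> int) \<times> ('i \<Rightarrow> int) \<Rightarrow> ('e \<Rightarrow>\<^sub>0 int) \<times> ('i \<Rightarrow>\<^sub>0 int) \<Rightarrow> int" where
  "uc_pre \<equiv> \<lambda>w. \<lambda>z\<in>carrier H1. ext_eval w z"

lemma ext_eval_add: "ext_eval w (c + c', b + b') = ext_eval w (c, b) + ext_eval w (c', b')"
  by (cases w) (simp add: chain_eval_add)

lemma ext_eval_mult:
  assumes "Poly_Mapping.keys c \<subseteq> arcs G" "Poly_Mapping.keys b \<subseteq> I"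
  shows "ext_eval (w \<otimes>\<^bsub>ext_cochains1 G I\<^esub> w') (c, b) = ext_eval w (c, b) + ext_eval w' (c, b)"
  using assms by (cases w; cases w') (simp add: chain_eval_add_left)

lemma uc_pre_hom: "uc_pre \<in> hom (ext_cochains1 G I) (dual_group H1)"
proof (rule homI)
  fix w w'
  show "uc_pre w \<in> carrier (dual_group H1)"
  proof -
    have "uc_pre w \<in> hom H1 integer_group"
    proof (rule homI)
      fix z z' assume z: "z \<in> carrier H1" "z' \<in> carrier H1"
      then have "z \<otimes>\<^bsub>H1\<^esub> z' \<in> carrier H1"
        using group_H1 by (simp add: group.is_monoid monoid.m_closed)
      with z show "uc_pre w (z \<otimes>\<^bsub>H1\<^esub> z') = uc_pre w z \<otimes>\<^bsub>integer_group\<^esub> uc_pre w z'"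
        by (cases z; cases z') (simp only: ext_eval_add H1_simps(2) restrict_apply' mult_integer_group)
    qed simp
    then show ?thesis by simp
  qed
  show "uc_pre (w \<otimes>\<^bsub>ext_cochains1 G I\<^esub> w') = uc_pre w \<otimes>\<^bsub>dual_group H1\<^esub> uc_pre w'"
    by (auto simp: ext_eval_mult intro!: restrict_ext)
qed

text \<open>By Stokes the value at \<open>(c, b)\<close> is \<open>f\<close> evaluated at
  \<open>boundary G c + push b\<close>, minus \<open>a\<close> times the degree of \<open>b\<close>;
  on a cycle both vanish.\<close>

lemma uc_pre_coboundary:
  assumes "w \<in> ext_coboundaries G I \<rho>"
  shows "uc_pre w = \<one>\<^bsub>dual_group H1\<^esub>"
proof -
  obtain f a where w: "w = (diff G f, \<lambda>i\<in>I. f (\<rho> i) - a)"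
    using assms by (auto simp: ext_coboundaries_def ext_diff_def)
  have "ext_eval w (c, b) = 0" if z: "(c, b) \<in> carrier H1" for c b
  proof -
    have "ext_eval w (c, b) = chain_eval f (boundary G c) + (chain_eval f (push b) - a * chain_degree b)"
      using z by (simp add: w chain_eval_diff_boundary chain_eval_push)
    then show ?thesis
      using z chain_eval_add[of f "boundary G c" "push b"] by simp
  qed
  then show ?thesis by (auto intro!: restrict_ext)
qed

text \<open>An arbitrary but fixed point of the modulus; its edge serves as the common first step
  out of \<open>\<star>\<close>.\<close>

definition base :: 'i where "base = (SOME i. i \<in> I)"

lemma base [simp]: "base \<in> I"
  using I_ne unfolding base_def by (metis ex_in_conv someI_ex)

definition path :: "'v \<Rightarrow> 'e \<Rightarrow>\<^sub>0 int" where
  "path v = (SOME c. Poly_Mapping.keys c \<subseteq> arcs G \<and> boundary G c = frag_of v - frag_of (\<rho> base))"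

lemma path:
  assumes "v \<in> verts G"
  shows "Poly_Mapping.keys (path v) \<subseteq> arcs G" "boundary G (path v) = frag_of v - frag_of (\<rho> base)"
  using someI_ex[OF path_chain_exists[OF conn rho_in_verts[OF base] assms]]
  by (simp_all add: path_def)

text \<open>
  The chain \<open>path v + e\<^sub>i\<close> with \<open>i = base\<close> joins \<open>\<star>\<close> to \<open>v\<close> in the extended graph. Closing up
  every edge along these chains gives the retractions \<open>loop_E\<close>, \<open>loop_I\<close> of the chains onto the cycles.
\<close>

definition loop_E :: "('e \<Rightarrow>\<^sub>0 int) \<Rightarrow> ('e \<Rightarrow>\<^sub>0 int) \<times> ('i \<Rightarrow>\<^sub>0 int)" where
  "loop_E c = (c - frag_extend path (boundary G c), 0)"

definition loop_I :: "('i \<Rightarrow>\<^sub>0 int) \<Rightarrow> ('e \<Rightarrow>\<^sub>0 int) \<times> ('i \<Rightarrow>\<^sub>0 int)" where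
  "loop_I b = (- frag_extend path (push b), b - frag_cmul (chain_degree b) (frag_of base))"

lemma keys_frag_extend_path: "Poly_Mapping.keys x \<subseteq> verts G \<Longrightarrow> Poly_Mapping.keys (frag_extend path x) \<subseteq> arcs G"
  by (rule keys_frag_extend_subset) (auto dest!: path(1))

lemma boundary_frag_extend_path:
  "Poly_Mapping.keys x \<subseteq> verts G \<Longrightarrow>
     boundary G (frag_extend path x) = x - frag_cmul (chain_degree x) (frag_of (\<rho> base))"
  by (rule boundary_frag_extend_paths[OF path(2)])

text \<open>A boundary has degree 0, so the paths leave no remainder at
  \<open>\<rho> base\<close>.\<close>

lemma loop_E_H1: "Poly_Mapping.keys c \<subseteq> arcs G \<Longrightarrow> loop_E c \<in> carrier H1"
  by (simp add: loop_E_def keys_diff_subset keys_frag_extend_path keys_boundary boundary_frag_extend_path)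

text \<open>The multiple of \<open>base\<close> that is subtracted brings the degree to 0, and its
  pushforward cancels the remainder that the paths leave at \<open>\<rho> base\<close>.\<close>

lemma loop_I_H1:
  assumes "Poly_Mapping.keys b \<subseteq> I"
  shows "loop_I b \<in> carrier H1"
proof -
  have "Poly_Mapping.keys (frag_cmul k (frag_of base)) \<subseteq> I" for k
    by (rule order_trans[OF keys_cmul]) simp
  then show ?thesis
    using assms
    by (simp add: loop_I_def keys_diff_subset keys_frag_extend_path keys_push boundary_frag_extend_path
        frag_extend_diff frag_extend_cmul chain_degree_diff)
qed

text \<open>A cochain that vanishes on all cycles is the differential of its own integral along the
  chosen paths from \<open>\<star>\<close>. Vanishing on the loops of single edges is all that is
  needed to see this.\<close>

lemma uc_pre_kernel: "kernel (ext_cochains1 G I) (dual_group H1) uc_pre = ext_coboundaries G I \<rho>"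
proof (intro subset_antisym subsetI)
  fix w assume "w \<in> ext_coboundaries G I \<rho>"
  then show "w \<in> kernel (ext_cochains1 G I) (dual_group H1) uc_pre"
    using uc_pre_coboundary subgroup.subset[OF ext_coboundaries_subgroup] unfolding kernel_def by blast
next
  fix w assume w: "w \<in> kernel (ext_cochains1 G I) (dual_group H1) uc_pre"
  obtain \<omega> h where \<omega>: "w = (\<omega>, h)" "\<omega> \<in> extensional (arcs G)" "h \<in> extensional I"
    using w by (cases w) (auto simp: kernel_def)
  have vanish: "ext_eval w z = 0" if "z \<in> carrier H1" for z
    using w that by (auto simp: kernel_def dest: fun_cong[of _ _ z])
  \<comment> \<open>The integral from \<open>\<star>\<close> to \<open>v\<close>: first along the
    edge of \<open>base\<close>, then along \<open>path v\<close>. The integral at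
    \<open>\<star>\<close> itself is 0, hence the pair \<open>(f, 0)\<close> below.\<close>
  define f where "f = (\<lambda>v\<in>verts G. chain_eval \<omega> (path v) + h base)"
  have "\<omega> e = f (head G e) - f (tail G e)" if e: "e \<in> arcs G" for e
    using vanish[OF loop_E_H1[of "frag_of e"]] e
    by (simp add: \<omega>(1) loop_E_def chain_eval_diff frag_extend_diff f_def)
  moreover have "h i = f (\<rho> i)" if i: "i \<in> I" for i
    using vanish[OF loop_I_H1[of "frag_of i"]] i chain_eval_diff[of \<omega> 0 "path (\<rho> i)"]
    by (simp add: \<omega>(1) loop_I_def chain_eval_diff f_def)
  ultimately have "w = ext_diff G I \<rho> (f, 0)"
    using \<omega> by (auto simp: ext_diff_def diff_def intro!: extensionalityI)
  moreover have "(f, 0) \<in> carrier (cochains (verts G) \<times>\<times> integer_group)" by (simp add: f_def)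
  ultimately show "w \<in> ext_coboundaries G I \<rho>" unfolding ext_coboundaries_def by blast
qed

lemma hom_H1_diff:
  assumes "\<phi> \<in> hom H1 integer_group" "(c, b) \<in> carrier H1" "(c', b') \<in> carrier H1"
    "(c - c', b - b') \<in> carrier H1"
  shows "\<phi> (c - c', b - b') = \<phi> (c, b) - \<phi> (c', b')"
  by (rule hom_integer_diff[OF group_H1 assms(1,2,3,4)]) simp

lemma hom_H1_zero: "\<phi> \<in> hom H1 integer_group \<Longrightarrow> \<phi> (0, 0) = 0"
  using hom_H1_diff[of \<phi> 0 0 0 0] by simp

text \<open>Composition with the retractions extends \<open>\<phi>\<close> from cycles to all
  chains; the values of the extension on single edges form the required cochain.\<close>

lemma uc_pre_surj: "uc_pre ` carrier (ext_cochains1 G I) = carrier (dual_group H1)"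
proof (intro subset_antisym subsetI)
  fix \<phi> assume \<phi>: "\<phi> \<in> carrier (dual_group H1)"
  then have hom: "\<phi> \<in> hom H1 integer_group" by simp
  define \<omega> where "\<omega> = (\<lambda>e\<in>arcs G. \<phi> (loop_E (frag_of e)))"
  define h where "h = (\<lambda>i\<in>I. \<phi> (loop_I (frag_of i)))"
  \<comment> \<open>The definition of \<open>\<omega>\<close> gives the equality on single arcs;
    both sides respect differences.\<close>
  have evE: "chain_eval \<omega> c = \<phi> (loop_E c)" if "Poly_Mapping.keys c \<subseteq> arcs G" for c
    using that
  proof (induction rule: free_Abelian_group_induct[consumes 1, case_names zero diff gen])
    case zero
    show ?case using hom_H1_zero[OF hom] by (simp add: loop_E_def)
  next
    case (diff x y)
    have eq: "loop_E (x - y) = (fst (loop_E x) - fst (loop_E y), snd (loop_E x) - snd (loop_E y))"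
      by (simp add: loop_E_def frag_extend_diff)
    show ?case
      using diff hom_H1_diff[OF hom, of "fst (loop_E x)" "snd (loop_E x)" "fst (loop_E y)" "snd (loop_E y)"]
        loop_E_H1[of x] loop_E_H1[of y] loop_E_H1[of "x - y"]
      by (simp only: chain_eval_diff eq prod.collapse keys_diff_subset)
  qed (simp add: \<omega>_def)
  have evI: "chain_eval h b = \<phi> (loop_I b)" if "Poly_Mapping.keys b \<subseteq> I" for b
    using that
  proof (induction rule: free_Abelian_group_induct[consumes 1, case_names zero diff gen])
    case zero
    show ?case using hom_H1_zero[OF hom] by (simp add: loop_I_def)
  next
    case (diff x y)
    have eq: "loop_I (x - y) = (fst (loop_I x) - fst (loop_I y), snd (loop_I x) - snd (loop_I y))"
      by (simp add: loop_I_def frag_extend_diff chain_degree_diff frag_cmul_diff_distrib)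
    show ?case
      using diff hom_H1_diff[OF hom, of "fst (loop_I x)" "snd (loop_I x)" "fst (loop_I y)" "snd (loop_I y)"]
        loop_I_H1[of x] loop_I_H1[of y] loop_I_H1[of "x - y"]
      by (simp only: chain_eval_diff eq prod.collapse keys_diff_subset)
  qed (simp add: h_def)
  have "ext_eval (\<omega>, h) (c, b) = \<phi> (c, b)" if z: "(c, b) \<in> carrier H1" for c b
  proof -
    have keys: "Poly_Mapping.keys c \<subseteq> arcs G" "Poly_Mapping.keys b \<subseteq> I" using z by auto
    \<comment> \<open>On a cycle the path corrections of the two loops cancel, and so does the
      \<open>base\<close> term since \<open>b\<close> has degree 0. Hence the loops add up to the
      cycle itself.\<close>
    have "frag_extend path (boundary G c) + frag_extend path (push b) = frag_extend path (boundary G c + push b)"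
      by (simp add: frag_extend_add)
    also have "\<dots> = 0" using z by simp
    finally have "loop_E c \<otimes>\<^bsub>H1\<^esub> loop_I b = (c, b)"
      using z by (simp add: loop_E_def loop_I_def algebra_simps eq_neg_iff_add_eq_0)
    then have "\<phi> (c, b) = \<phi> (loop_E c) + \<phi> (loop_I b)"
      using hom_mult[OF hom loop_E_H1[OF keys(1)] loop_I_H1[OF keys(2)]] by simp
    then show ?thesis by (simp add: evE evI keys)
  qed
  then have "uc_pre (\<omega>, h) = \<phi>"
    using \<phi> by (intro extensionalityI[of _ "carrier H1"]) auto
  moreover have "(\<omega>, h) \<in> carrier (ext_cochains1 G I)" by (simp add: \<omega>_def h_def)
  ultimately show "\<phi> \<in> uc_pre ` carrier (ext_cochains1 G I)" by blast
qed (use uc_pre_hom in \<open>auto simp: hom_def\<close>)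

lemma group_dual_H1: "group (dual_group H1)"
  by (rule comm_group.axioms(2)[OF comm_group_dual_group[OF group_H1]])

lemma ext_universal_coeff_iso: "ext_universal_coeff G I \<rho> \<in> iso (ext_coH1 G I \<rho>) (dual_group H1)"
  unfolding ext_universal_coeff_def ext_coH1_def
  by (rule quot_map_iso[OF comm_group.axioms(2)[OF comm_group_ext_cochains1] group_dual_H1
        uc_pre_hom uc_pre_kernel uc_pre_surj])

lemma ext_universal_coeff_class:
  "w \<in> carrier (ext_cochains1 G I) \<Longrightarrow> ext_universal_coeff G I \<rho> (coh_class w) = uc_pre w"
  unfolding ext_universal_coeff_def
  by (rule quot_map_coset[OF ext_coboundaries_normal group_dual_H1 uc_pre_hom]) (simp_all add: uc_pre_kernel)

end


section \<open>The Jacobian\<close>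

context graph_with_modulus
begin

abbreviation chain_cochain :: "('e \<Rightarrow>\<^sub>0 int) \<times> ('i \<Rightarrow>\<^sub>0 int) \<Rightarrow> ('e \<Rightarrow> int) \<times> ('i \<Rightarrow> int)" where
  "chain_cochain \<equiv> ext_chain_to_cochain G I"

lemma chain_cochain_eq: "chain_cochain (c, b) = (chain_to_cochain (arcs G) c, chain_to_cochain I b)"
  by (simp add: ext_chain_to_cochain_def)

lemma chain_cochain_hom: "chain_cochain \<in> hom (ext_chains1 G I) (ext_cochains1 G I)"
proof (rule homI)
  fix z w :: "('e \<Rightarrow>\<^sub>0 int) \<times> ('i \<Rightarrow>\<^sub>0 int)"
  show "chain_cochain z \<in> carrier (ext_cochains1 G I)"
    by (cases z) (simp add: chain_cochain_eq chain_to_cochain_def)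
  show "chain_cochain (z \<otimes>\<^bsub>ext_chains1 G I\<^esub> w) = chain_cochain z \<otimes>\<^bsub>ext_cochains1 G I\<^esub> chain_cochain w"
    by (cases z; cases w) (auto simp: chain_cochain_eq chain_to_cochain_def lookup_add intro!: restrict_ext)
qed

text \<open>The coefficients of \<open>boundary G c + push b\<close> are the values in the first
  harmonicity condition, and the degree of \<open>b\<close> is the sum in the second. Harmonicity is
  the cycle condition read in coefficients.\<close>

lemma chain_cochain_Harm_iff:
  assumes c: "Poly_Mapping.keys c \<subseteq> arcs G" and b: "Poly_Mapping.keys b \<subseteq> I"
  shows "chain_cochain (c, b) \<in> carrier Harm \<longleftrightarrow> (c, b) \<in> carrier H1"
proof -
  have deg: "sum (chain_to_cochain I b) I = chain_degree b"
    by (rule sum_chain_to_cochain[OF fin_I b])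
  let ?x = "boundary G c + push b"
  have keys: "Poly_Mapping.keys ?x \<subseteq> verts G" using c b by (simp add: keys_add_subset keys_boundary keys_push)
  have val: "diff_adj G (chain_to_cochain (arcs G) c) v + rho_push_cochain I \<rho> (chain_to_cochain I b) v
      = Poly_Mapping.lookup ?x v" if v: "v \<in> verts G" for v
    using chain_to_cochain_boundary[OF finite_arcs c] chain_to_cochain_push[OF fin_I b v, of \<rho>] v
    by (auto simp: chain_to_cochain_def lookup_add dest: fun_cong[of _ _ v])
  \<comment> \<open>The chain is supported on the vertices, so it is enough to test its coefficients
    there.\<close>
  have "(\<forall>v\<in>verts G. Poly_Mapping.lookup ?x v = 0) \<longleftrightarrow> ?x = 0"
  proof
    assume "\<forall>v\<in>verts G. Poly_Mapping.lookup ?x v = 0"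
    then have "Poly_Mapping.keys ?x = {}" using keys by (meson equals0I in_keys_iff subsetD)
    then show "?x = 0" by (simp only: keys_eq_empty)
  qed simp
  then show ?thesis
    using c b by (simp add: ext_harmonic_def chain_cochain_eq deg val) (simp add: chain_to_cochain_def)
qed

lemma chain_cochain_H1_image: "chain_cochain ` carrier H1 = carrier Harm"
proof (intro subset_antisym subsetI)
  fix w assume "w \<in> chain_cochain ` carrier H1"
  then show "w \<in> carrier Harm" using chain_cochain_Harm_iff by auto
next
  fix w assume w: "w \<in> carrier Harm"
  obtain f g where fg: "w = (f, g)" by force
  then have ext: "f \<in> extensional (arcs G)" "g \<in> extensional I"
    using w by (auto simp: ext_harmonic_def)
  obtain c where c: "Poly_Mapping.keys c \<subseteq> arcs G" "chain_to_cochain (arcs G) c = f"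
    using chain_to_cochain_surj[OF finite_arcs ext(1)] .
  obtain b where b: "Poly_Mapping.keys b \<subseteq> I" "chain_to_cochain I b = g"
    using chain_to_cochain_surj[OF fin_I ext(2)] .
  have "w = chain_cochain (c, b)" by (simp add: fg c b chain_cochain_eq)
  moreover from this have "(c, b) \<in> carrier H1" using chain_cochain_Harm_iff[OF c(1) b(1)] w by simp
  ultimately show "w \<in> chain_cochain ` carrier H1" by blast
qed

lemma Harm_subgroup: "subgroup (carrier Harm) (ext_cochains1 G I)"
proof -
  interpret group_hom "ext_chains1 G I" "ext_cochains1 G I" chain_cochain
    by (simp add: group_hom_def group_hom_axioms_def group_ext_chains1 chain_cochain_hom
        comm_group.axioms(2)[OF comm_group_ext_cochains1])
  show ?thesis using subgroup_img_is_subgroup[OF H1_subgroup] by (simp add: chain_cochain_H1_image)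
qed

lemma group_Harm: "group Harm"
  using subgroup.subgroup_is_group[OF Harm_subgroup comm_group.axioms(2)[OF comm_group_ext_cochains1]]
  by (simp add: ext_harmonic_def subgrp_def)

lemma mult_Harm [simp]: "w \<otimes>\<^bsub>Harm\<^esub> w' = w \<otimes>\<^bsub>ext_cochains1 G I\<^esub> w'"
  by (simp add: ext_harmonic_def)

lemma mult_H1: "z \<otimes>\<^bsub>H1\<^esub> z' = z \<otimes>\<^bsub>ext_chains1 G I\<^esub> z'"
  by (simp add: ext_H1_def)

lemma chain_cochain_iso: "chain_cochain \<in> iso H1 Harm"
  unfolding iso_def bij_betw_def
proof (intro CollectI conjI homI inj_onI)
  show "z = z'" if "z \<in> carrier H1" "z' \<in> carrier H1" "chain_cochain z = chain_cochain z'" for z z'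
    using that chain_to_cochain_inj[of "fst z" "arcs G" "fst z'"] chain_to_cochain_inj[of "snd z" I "snd z'"]
    by (cases z; cases z') (simp add: chain_cochain_eq)
  show "chain_cochain (z \<otimes>\<^bsub>H1\<^esub> z') = chain_cochain z \<otimes>\<^bsub>Harm\<^esub> chain_cochain z'"
    if "z \<in> carrier H1" "z' \<in> carrier H1" for z z'
    unfolding mult_H1 mult_Harm
    by (rule hom_mult[OF chain_cochain_hom]) (use that subgroup.subset[OF H1_subgroup] in blast)+
qed (use chain_cochain_H1_image in blast)+

section \<open>The transpose of the coefficient map and the map from the Jacobian to the Picard
  group\<close>

lemma iota_transpose_iso: "iota_transpose G I \<rho> \<in> iso (dual_group Harm) (dual_group H1)"
  using dual_iso[OF group_H1 group_Harm chain_cochain_iso] by (simp add: iota_transpose_def[abs_def])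

abbreviation zeta_pre :: "(('e \<Rightarrow> int) \<times> ('i \<Rightarrow> int) \<Rightarrow> int) \<Rightarrow> (('e \<Rightarrow> int) \<times> ('i \<Rightarrow> int)) set" where
  "zeta_pre \<phi> \<equiv> inv_into (carrier (ext_coH1 G I \<rho>)) (ext_universal_coeff G I \<rho>) (iota_transpose G I \<rho> \<phi>)"

lemma zeta_pre_iso: "zeta_pre \<in> iso (dual_group Harm) (ext_coH1 G I \<rho>)"
  using iso_set_trans[OF iota_transpose_iso
      group.iso_set_sym[OF comm_group.axioms(2)[OF comm_group_ext_coH1] ext_universal_coeff_iso]]
  by (simp add: comp_def)

abbreviation eval_class :: "('e \<Rightarrow>\<^sub>0 int) \<times> ('i \<Rightarrow>\<^sub>0 int) \<Rightarrow> ('e \<Rightarrow> int) \<times> ('i \<Rightarrow> int) \<Rightarrow> int" where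
  "eval_class z \<equiv> \<lambda>w\<in>carrier Harm. ext_eval w z"

lemma eval_class_dual:
  assumes z: "z \<in> carrier (ext_chains1 G I)"
  shows "eval_class z \<in> carrier (dual_group Harm)"
proof -
  have "eval_class z \<in> hom Harm integer_group"
  proof (rule homI)
    fix w w' assume w: "w \<in> carrier Harm" "w' \<in> carrier Harm"
    then have "w \<otimes>\<^bsub>Harm\<^esub> w' \<in> carrier Harm"
      using group_Harm by (simp only: group.is_monoid monoid.m_closed)
    then show "eval_class z (w \<otimes>\<^bsub>Harm\<^esub> w') = eval_class z w \<otimes>\<^bsub>integer_group\<^esub> eval_class z w'"
      using w z by (cases z) (simp add: ext_eval_mult)
  qed simp
  then show ?thesis by simp
qed

text \<open>The transpose of \<open>\<iota>\<close> is computed by the symmetry of the coefficient pairing.\<close>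

lemma zeta_pre_eval:
  assumes z: "z \<in> carrier (ext_chains1 G I)"
  shows "zeta_pre (eval_class z) = coh_class (chain_cochain z)"
proof -
  obtain c b where cb: "z = (c, b)" "Poly_Mapping.keys c \<subseteq> arcs G" "Poly_Mapping.keys b \<subseteq> I"
    using z by (cases z) auto
  have w: "chain_cochain z \<in> carrier (ext_cochains1 G I)"
    by (rule hom_in_carrier[OF chain_cochain_hom z])
  have "iota_transpose G I \<rho> (eval_class z) = uc_pre (chain_cochain z)"
    unfolding iota_transpose_def
  proof (rule restrict_ext)
    fix y assume y: "y \<in> carrier H1"
    then have "chain_cochain y \<in> carrier Harm" using chain_cochain_H1_image by blast
    then show "eval_class z (chain_cochain y) = ext_eval (chain_cochain z) y"
      using y cb chain_eval_chain_to_cochain_commute[OF finite_arcs, of c "fst y"]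
        chain_eval_chain_to_cochain_commute[OF fin_I, of b "snd y"]
      by (cases y) (simp add: chain_cochain_eq)
  qed
  also have "\<dots> = ext_universal_coeff G I \<rho> (coh_class (chain_cochain z))"
    using ext_universal_coeff_class[OF w] by simp
  finally show ?thesis
    using ext_universal_coeff_iso w by (simp add: iso_def bij_betw_def inv_into_f_f carrier_ext_coH1)
qed

text \<open>Brings \<open>alpha_m\<close> into the form to which \<open>zeta_pre_eval\<close>
  applies.\<close>

lemma alpha_m_eq: "alpha_m G I \<rho> \<gamma> = eval_class (\<gamma>, 0)"
  unfolding alpha_m_def by (auto intro!: restrict_ext)

lemma keys_cycles: "\<gamma> \<in> cycles G \<Longrightarrow> Poly_Mapping.keys \<gamma> \<subseteq> arcs G"
  by (simp add: cycles_def kernel_def)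

text \<open>Coefficients turn \<open>boundary\<close> into \<open>diff_adj\<close> and are injective
  on vertex chains, so they match the two kernels.\<close>

lemma cycles_harmonic: "chain_to_cochain (arcs G) ` cycles G = harmonic G"
proof (intro subset_antisym subsetI)
  fix \<omega> assume "\<omega> \<in> chain_to_cochain (arcs G) ` cycles G"
  then obtain c where c: "Poly_Mapping.keys c \<subseteq> arcs G" "boundary G c = 0" "\<omega> = chain_to_cochain (arcs G) c"
    by (auto simp: cycles_def kernel_def)
  then have "diff_adj G \<omega> = (\<lambda>v\<in>verts G. 0)"
    using chain_to_cochain_boundary[OF finite_arcs c(1)] by (simp add: chain_to_cochain_def)
  then show "\<omega> \<in> harmonic G" by (simp add: harmonic_def kernel_def c(3) chain_to_cochain_def)
next
  fix \<omega> assume \<omega>: "\<omega> \<in> harmonic G"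
  then have "\<omega> \<in> extensional (arcs G)" by (simp add: harmonic_def kernel_def)
  then obtain c where c: "Poly_Mapping.keys c \<subseteq> arcs G" "chain_to_cochain (arcs G) c = \<omega>"
    using chain_to_cochain_surj[OF finite_arcs] by metis
  have "chain_to_cochain (verts G) (boundary G c) = chain_to_cochain (verts G) 0"
    using \<omega> by (simp add: chain_to_cochain_boundary c harmonic_def kernel_def) (simp add: chain_to_cochain_def)
  then have "boundary G c = 0"
    using chain_to_cochain_inj[of "boundary G c" "verts G" 0] keys_boundary[OF c(1)] by simp
  then show "\<omega> \<in> chain_to_cochain (arcs G) ` cycles G"
    using c by (auto simp: cycles_def kernel_def)
qed

text \<open>For a cycle \<open>\<gamma>\<close>, \<open>zeta_pre_eval\<close> at
  \<open>(\<gamma>, 0)\<close> yields the class of its coefficients, and these run through all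
  harmonic cochains. This lets \<open>zeta_pre\<close> descend to an isomorphism of the
  quotients.\<close>

lemma zeta_pre_alpha: "zeta_pre ` alpha_m G I \<rho> ` cycles G = beta_m G I \<rho> ` harmonic G"
proof -
  have "zeta_pre (alpha_m G I \<rho> \<gamma>) = beta_m G I \<rho> (chain_to_cochain (arcs G) \<gamma>)" if "\<gamma> \<in> cycles G" for \<gamma>
    using zeta_pre_eval[of "(\<gamma>, 0)"] keys_cycles[OF that]
    by (simp add: alpha_m_eq beta_m_def chain_cochain_eq) (simp add: chain_to_cochain_def)
  then show ?thesis
    unfolding cycles_harmonic[symmetric] image_image by (rule image_cong[OF refl])
qed

lemma comm_group_dual_Harm: "comm_group (dual_group Harm)"
  by (rule comm_group_dual_group[OF group_Harm])

lemma alpha_image_subgroup: "subgroup (alpha_m G I \<rho> ` cycles G) (dual_group Harm)"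
proof -
  interpret d: group_hom "free_Abelian_group (arcs G)" "free_Abelian_group (verts G)" "boundary G"
    by (simp add: group_hom_def group_hom_axioms_def hom_def keys_boundary Pi_iff)
  have hom: "alpha_m G I \<rho> \<in> hom (free_Abelian_group (arcs G)) (dual_group Harm)"
  proof (rule homI)
    show "alpha_m G I \<rho> c \<in> carrier (dual_group Harm)" if "c \<in> carrier (free_Abelian_group (arcs G))" for c
      unfolding alpha_m_eq by (rule eval_class_dual) (use that in simp)
    show "alpha_m G I \<rho> (c \<otimes>\<^bsub>free_Abelian_group (arcs G)\<^esub> c') = alpha_m G I \<rho> c \<otimes>\<^bsub>dual_group Harm\<^esub> alpha_m G I \<rho> c'" for c c'
      by (auto simp: alpha_m_eq chain_eval_add intro!: restrict_ext)
  qed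
  interpret a: group_hom "free_Abelian_group (arcs G)" "dual_group Harm" "alpha_m G I \<rho>"
    by (simp only: group_hom_def group_hom_axioms_def hom group_free_Abelian_group
        comm_group.axioms(2)[OF comm_group_dual_Harm])
  show ?thesis unfolding cycles_def by (rule a.subgroup_img_is_subgroup[OF d.subgroup_kernel])
qed

lemma zeta_m_iso: "zeta_m G I \<rho> \<in> iso (Jac G I \<rho>) (Pic G I \<rho>)"
  and zeta_m_coset: "\<phi> \<in> carrier (dual_group Harm) \<Longrightarrow>
    zeta_m G I \<rho> ((alpha_m G I \<rho> ` cycles G) #>\<^bsub>dual_group Harm\<^esub> \<phi>)
      = (beta_m G I \<rho> ` harmonic G) #>\<^bsub>ext_coH1 G I \<rho>\<^esub> zeta_pre \<phi>"
proof -
  note q = quot_map_iso_of_iso[OF comm_group.axioms(2)[OF comm_group_dual_Harm] comm_group_ext_coH1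
      alpha_image_subgroup zeta_pre_iso zeta_pre_alpha]
  show "zeta_m G I \<rho> \<in> iso (Jac G I \<rho>) (Pic G I \<rho>)"
    unfolding zeta_m_def Jac_def Pic_def by (rule q(1))
  show "zeta_m G I \<rho> ((alpha_m G I \<rho> ` cycles G) #>\<^bsub>dual_group Harm\<^esub> \<phi>)
      = (beta_m G I \<rho> ` harmonic G) #>\<^bsub>ext_coH1 G I \<rho>\<^esub> zeta_pre \<phi>" if "\<phi> \<in> carrier (dual_group Harm)"
    unfolding zeta_m_def by (rule q(2)[OF that])
qed


section \<open>The commutative diagram\<close>

text \<open>The first component has degree 0 and is therefore a boundary, so the value of
  \<open>AJ_m\<close> on every class is given by \<open>AJ_m_class\<close>.\<close>

lemma Cl_representative:
  assumes "X \<in> carrier (Cl G I \<rho>)"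
  obtains \<gamma> b where "Poly_Mapping.keys \<gamma> \<subseteq> arcs G" "Poly_Mapping.keys b \<subseteq> I"
    "X = Cl_rel G I \<rho> #>\<^bsub>Cl_amb G I\<^esub> (boundary G \<gamma>, b)"
proof -
  obtain x b where xb: "(x, b) \<in> carrier (Cl_amb G I)" "X = Cl_rel G I \<rho> #>\<^bsub>Cl_amb G I\<^esub> (x, b)"
    using assms unfolding Cl_def carrier_FactGroup by auto
  obtain \<gamma> where "Poly_Mapping.keys \<gamma> \<subseteq> arcs G" "boundary G \<gamma> = x"
    using xb(1) boundary_surj_degree_0[OF conn, of x] by auto
  then show thesis using that xb by auto
qed

lemma AJ_m_coset:
  assumes "Poly_Mapping.keys \<gamma> \<subseteq> arcs G"
  shows "AJ_m G I \<rho> (Cl_rel G I \<rho> #>\<^bsub>Cl_amb G I\<^esub> (boundary G \<gamma>, b))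
    = (alpha_m G I \<rho> ` cycles G) #>\<^bsub>dual_group Harm\<^esub> eval_class (\<gamma>, b)"
  by (rule AJ_m_class) (use assms fin_I in auto)

lemma AJ_m_in_Jac:
  assumes "X \<in> carrier (Cl G I \<rho>)"
  shows "AJ_m G I \<rho> X \<in> carrier (Jac G I \<rho>)"
proof -
  obtain \<gamma> b where \<gamma>: "Poly_Mapping.keys \<gamma> \<subseteq> arcs G" "Poly_Mapping.keys b \<subseteq> I"
    "X = Cl_rel G I \<rho> #>\<^bsub>Cl_amb G I\<^esub> (boundary G \<gamma>, b)"
    using Cl_representative[OF assms] .
  have "eval_class (\<gamma>, b) \<in> carrier (dual_group Harm)"
    by (rule eval_class_dual) (use \<gamma> in simp)
  then show ?thesis
    unfolding \<gamma>(3) AJ_m_coset[OF \<gamma>(1)] Jac_def carrier_FactGroup by (rule imageI)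
qed

lemma diagram_commutes:
  assumes "X \<in> carrier (Cl G I \<rho>)"
  shows "chi_m G I \<rho> (zeta_m G I \<rho> (AJ_m G I \<rho> X)) = iota_m G I \<rho> X"
proof -
  obtain \<gamma> b where \<gamma>: "Poly_Mapping.keys \<gamma> \<subseteq> arcs G" "Poly_Mapping.keys b \<subseteq> I"
    "X = Cl_rel G I \<rho> #>\<^bsub>Cl_amb G I\<^esub> (boundary G \<gamma>, b)"
    using Cl_representative[OF assms] .
  have z: "(\<gamma>, b) \<in> carrier (ext_chains1 G I)" using \<gamma> by simp
  have "chi_m G I \<rho> (zeta_m G I \<rho> (AJ_m G I \<rho> X)) = chi_pre (chain_cochain (\<gamma>, b))"
    unfolding \<gamma>(3) AJ_m_coset[OF \<gamma>(1)] zeta_m_coset[OF eval_class_dual[OF z]] zeta_pre_eval[OF z]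
    by (rule chi_m_coset[OF hom_in_carrier[OF chain_cochain_hom z]])
  \<comment> \<open>Applying \<open>diff_adj\<close> to the coefficients of \<open>\<gamma>\<close>
    gives the coefficients of its boundary.\<close>
  also have "\<dots> = Clhat_class G I \<rho> (cl_cochain (boundary G \<gamma>, b))"
    by (simp add: Clhat_class_def chain_cochain_eq chain_to_cochain_boundary \<gamma>(1))
  also have "\<dots> = iota_m G I \<rho> X"
    unfolding \<gamma>(3) by (rule iota_m_coset[symmetric]) (use \<gamma> in \<open>simp add: keys_boundary\<close>)
  finally show ?thesis .
qed

lemma AJ_m_iso: "AJ_m G I \<rho> \<in> iso (Cl G I \<rho>) (Jac G I \<rho>)"
proof -
  let ?F = "chi_m G I \<rho> \<circ> zeta_m G I \<rho>"
  interpret Cl: group "Cl G I \<rho>"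
    unfolding Cl_def
    by (rule comm_group.axioms(2)[OF comm_group.abelian_FactGroup[OF comm_group_Cl_amb Cl_rel_subgroup]])
  interpret Jac: group "Jac G I \<rho>"
    unfolding Jac_def
    by (rule comm_group.axioms(2)[OF comm_group.abelian_FactGroup[OF comm_group_dual_Harm alpha_image_subgroup]])
  have F: "?F \<in> iso (Jac G I \<rho>) (Clhat G I \<rho>)"
    by (rule iso_set_trans[OF zeta_m_iso chi_m_iso])
  show ?thesis
  \<comment> \<open>A map that agrees on the carrier with an isomorphism is one. By the diagram,
    \<open>AJ_m\<close> agrees with \<open>iota_m\<close> followed by the inverse of
    \<open>?F\<close>.\<close>
  proof (rule Cl.iso_eq[OF iso_set_trans[OF iota_m_iso Jac.iso_set_sym[OF F]]])
    fix X assume X: "X \<in> carrier (Cl G I \<rho>)"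
    have "iota_m G I \<rho> X = ?F (AJ_m G I \<rho> X)"
      by (simp add: diagram_commutes[OF X])
    \<comment> \<open>Cancelling \<open>?F\<close> uses its injectivity on the Jacobian, which
      requires \<open>AJ_m_in_Jac\<close>.\<close>
    then show "AJ_m G I \<rho> X = (inv_into (carrier (Jac G I \<rho>)) ?F \<circ> iota_m G I \<rho>) X"
      using F AJ_m_in_Jac[OF X] by (simp only: o_apply[of _ "iota_m G I \<rho>"] iso_def bij_betw_def mem_Collect_eq inv_into_f_f)
  qed
qed

end

theorem theorem3p4p5:
  fixes G :: "('v, 'e) pre_digraph" and I :: "'i set" and \<rho> :: "'i \<Rightarrow> 'v"
  assumes "fin_digraph G"
    and "Digraph_Component.connected G"
    and "finite I" and "I \<noteq> {}" and "\<rho> \<in> I \<rightarrow> verts G"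
  shows "iota_m G I \<rho> \<in> iso (Cl G I \<rho>) (Clhat G I \<rho>)
       \<and> AJ_m G I \<rho> \<in> iso (Cl G I \<rho>) (Jac G I \<rho>)
       \<and> zeta_m G I \<rho> \<in> iso (Jac G I \<rho>) (Pic G I \<rho>)
       \<and> chi_m G I \<rho> \<in> iso (Pic G I \<rho>) (Clhat G I \<rho>)
       \<and> (\<forall>x\<in>carrier (Cl G I \<rho>). chi_m G I \<rho> (zeta_m G I \<rho> (AJ_m G I \<rho> x)) = iota_m G I \<rho> x)"
proof -
  interpret graph_with_modulus G I \<rho>
    using assms by (simp add: graph_with_modulus_def graph_with_modulus_axioms_def)
  show ?thesis
    using iota_m_iso AJ_m_iso zeta_m_iso chi_m_iso diagram_commutes by blast
qed

end
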